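(* Let $T$ be a coset template. If $\mathrm{CSP}(T)$ is solvable by a local equivariant algorithm, then $T$ is 2-Helly.
   Context: A template $T$ is a finite relational structure: a finite carrier set (also denoted $T$) with a finite family of relations $R\subseteq T^n$, each of a specified arity. An instance $I$ over $T$ is a finite set $I$ of elements with a finite set of constraints $R(a_1,\dots,a_n)$, where $R$ is an $n$-ary template relation and $a_1,\dots,a_n\in I$. A partial function $h:I\rightharpoonup T$ is a partial solution if it satisfies every constraint $R(a_1,\dots,a_n)$ with $\{a_1,\dots,a_n\}\subseteq\mathrm{dom}(h)$, i.e. $(h(a_1),\dots,h(a_n))\in R$; it is a solution if in addition it is total. Its size is $|\mathrm{dom}(h)|$. $\mathrm{CSP}(T)$ asks whether a given instance has a solution. For $k<j$, a $(k,j)$-anomaly of $I$ is a partial solution $h$ of size $j$ that does not extend to a solution of $I$, while the restriction of $h$ to every $k$-element subset of $\mathrm{dom}(h)$ extends to a solution. $T$ is 2-Helly if no instance over $T$ admits a $(2,j)$-anomaly for any $j>2$. A coset template is a template $T$ such that: the carrier set is a disjoint union of finite groups (carrier groups); every $n$-ary relation is a right coset in a direct product $G_1\times\dots\times G_n$ of carrier groups; for every relation $R\subseteq G_1\times\dots\times G_n$ and every $\pi\in G_1\times\dots\times G_n$, the coset $R\pi$ is also a relation of $T$; and for every carrier group $G$, $T$ has the unary relation $\{1\}$ consisting of the identity of $G$. For a constraint $R(a_1,\dots,a_n)$ with $R\subseteq G_1\times\dots\times G_n$, $G_i$ is called a constraining group of $a_i$; instances are assumed non-contradictory, i.e. every element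 has exactly one constraining group. A pre-solution of $I$ is a map $s$ sending each element of $I$ into its constraining group; pre-solutions form a group under pointwise multiplication. For a pre-solution $s$, $I\cdot s$ is the instance with the same elements in which each constraint $R(a_1,\dots,a_n)$ of $I$ is replaced by $(R\pi)(a_1,\dots,a_n)$ with $\pi=(s(a_1),\dots,s(a_n))$. Algorithms: a (deterministic) algorithm runs in stages; on input $I$ it computes objects $\mathcal D_1(I),\dots,\mathcal D_{n(I)}(I)$, where $\mathcal D_i(I)$ is a function of $I$ and $\mathcal D_1(I),\dots,\mathcal D_{i-1}(I)$, and its outcome (accept/reject) is determined by $\mathcal D_{n(I)}(I)$. It is assumed that pre-solutions $s$ of $I$ act on the objects, written $\mathcal D_i(I)\cdot s$. The algorithm is equivariant if for every instance $I$ and pre-solution $s$ of $I$: $n(I\cdot s)=n(I)$ and $\mathcal D_i(I\cdot s)=\mathcal D_i(I)\cdot s$ for all $i\le n(I)$. A pre-solution $s$ fixes $\mathcal S\subseteq I$ if $s(x)=1$ for all $x\in\mathcal S$. An equivariant algorithm is local if there is $d\in\mathbb N$ (independent of the instance) such that for every instance $I$ and every $i\le n(I)$, either (L0) holds, or both (L1) and (L2) hold: (L0) there is $\mathcal S\subseteq I$ with $|\mathcal S|\le d$ such that $\mathcal D_i(I)$ depends only on the restriction of $I$ to $\mathcal S$; (L1) $\mathcal D_i(I)$ depends on at most $d$ of the objects $\mathcal D_1(I),\dots,\mathcal D_{i-1}(I)$; (L2) there is $\mathcal S\subseteq I$ with $|\mathcal S|\le d$ such that $\mathcal D_i(I)\cdot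 s=\mathcal D_i(I)$ for every pre-solution $s$ fixing $\mathcal S$. The algorithm solves $\mathrm{CSP}(T)$ if it accepts exactly the instances over $T$ that have a solution.
   Formalization: The last object is also required to determine that the run stops (n(I) is the first stage whose object carries a verdict); with n(I) an arbitrary translation-invariant number, as literally stated, n(I) could itself encode solvability and the claim would be false. *)

theory Defs
  imports "HOL-Algebra.Algebra" "HOL-Library.Infinite_Typeclass"
begin

section \<open>Templates and instances\<close>

text \<open>A relation is stored with its arity, as a set of lists of that length.\<close>

type_synonym 't relation = "nat \<times> 't list set"

record 't template =
  tcarrier :: "'t set"
  trels :: "'t relation set"

definition template :: "'t template \<Rightarrow> bool" where
  "template T \<longleftrightarrow> finite (tcarrier T) \<and> finite (trels T) \<and>
     (\<forall>(n, R) \<in> trels T. \<forall>t \<in> R. length t = n \<and> set t \<subseteq> tcarrier T)"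

text \<open>The constraint $R(a_1,\dots,a_n)$ is the pair \<open>((n, R), [a\<^sub>1, \<dots>, a\<^sub>n])\<close>.\<close>

record ('t, 'e) inst =
  elems :: "'e set"
  constrs :: "('t relation \<times> 'e list) set"

definition inst_over :: "'t template \<Rightarrow> ('t, 'e) inst \<Rightarrow> bool" where
  "inst_over T I \<longleftrightarrow> finite (elems I) \<and> finite (constrs I) \<and>
     (\<forall>((n, R), as) \<in> constrs I. (n, R) \<in> trels T \<and> length as = n \<and> set as \<subseteq> elems I)"

definition restrict_inst :: "('t, 'e) inst \<Rightarrow> 'e set \<Rightarrow> ('t, 'e) inst" where
  "restrict_inst I S =
     \<lparr>elems = elems I \<inter> S, constrs = {(R, as) \<in> constrs I. set as \<subseteq> S}\<rparr>"

definition partial_solution :: "'t template \<Rightarrow> ('t, 'e) inst \<Rightarrow> ('e \<rightharpoonup> 't) \<Rightarrow> bool" where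
  "partial_solution T I h \<longleftrightarrow> dom h \<subseteq> elems I \<and> ran h \<subseteq> tcarrier T \<and>
     (\<forall>((n, R), as) \<in> constrs I. set as \<subseteq> dom h \<longrightarrow> map (\<lambda>a. the (h a)) as \<in> R)"

definition solution :: "'t template \<Rightarrow> ('t, 'e) inst \<Rightarrow> ('e \<rightharpoonup> 't) \<Rightarrow> bool" where
  "solution T I h \<longleftrightarrow> partial_solution T I h \<and> dom h = elems I"

definition extends_to_solution :: "'t template \<Rightarrow> ('t, 'e) inst \<Rightarrow> ('e \<rightharpoonup> 't) \<Rightarrow> bool" where
  "extends_to_solution T I h \<longleftrightarrow> (\<exists>g. solution T I g \<and> h \<subseteq>\<^sub>m g)"

definition anomaly :: "'t template \<Rightarrow> ('t, 'e) inst \<Rightarrow> nat \<Rightarrow> nat \<Rightarrow> ('e \<rightharpoonup> 't) \<Rightarrow> bool" where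
  "anomaly T I k j h \<longleftrightarrow> k < j \<and> partial_solution T I h \<and> card (dom h) = j \<and>
     \<not> extends_to_solution T I h \<and>
     (\<forall>Y \<subseteq> dom h. card Y = k \<longrightarrow> extends_to_solution T I (h |` Y))"

text \<open>The type argument only fixes the type from which elements of instances are drawn;
  for a faithful reading it has to be infinite.\<close>

definition two_helly :: "'e itself \<Rightarrow> 't template \<Rightarrow> bool" where
  "two_helly (_ :: 'e itself) T \<longleftrightarrow>
     (\<forall>I :: ('t, 'e) inst. inst_over T I \<longrightarrow> (\<forall>j > 2. \<nexists>h. anomaly T I 2 j h))"

section \<open>Coset templates\<close>

text \<open>\<open>\<G>\<close> is the set of carrier groups. In HOL-Algebra, \<open>H #>\<^bsub>P\<^esub> \<pi>\<close> is the set of all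
  \<open>h \<otimes>\<^bsub>P\<^esub> \<pi>\<close> with \<open>h \<in> H\<close>, for an arbitrary set \<open>H\<close>; so it also expresses the
  translate $R\pi$ of a coset $R$.\<close>

definition coset_template :: "'t template \<Rightarrow> 't monoid set \<Rightarrow> bool" where
  "coset_template T \<G> \<longleftrightarrow> template T \<and>
     (\<forall>G \<in> \<G>. group G \<and> finite (carrier G)) \<and>
     (\<forall>G \<in> \<G>. \<forall>H \<in> \<G>. G \<noteq> H \<longrightarrow> carrier G \<inter> carrier H = {}) \<and>
     tcarrier T = (\<Union>G \<in> \<G>. carrier G) \<and>
     (\<forall>(n, R) \<in> trels T. \<exists>Gs H. length Gs = n \<and> set Gs \<subseteq> \<G> \<and>
        subgroup H (DirProd_list Gs) \<and> R \<in> rcosets\<^bsub>DirProd_list Gs\<^esub> H) \<and>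
     (\<forall>(n, R) \<in> trels T. \<forall>Gs. length Gs = n \<and> set Gs \<subseteq> \<G> \<and> R \<subseteq> carrier (DirProd_list Gs) \<longrightarrow>
        (\<forall>\<pi> \<in> carrier (DirProd_list Gs). (n, R #>\<^bsub>DirProd_list Gs\<^esub> \<pi>) \<in> trels T)) \<and>
     (\<forall>G \<in> \<G>. (1, {[\<one>\<^bsub>G\<^esub>]}) \<in> trels T)"

definition constraining_group ::
    "'t monoid set \<Rightarrow> ('t, 'e) inst \<Rightarrow> 'e \<Rightarrow> 't monoid \<Rightarrow> bool" where
  "constraining_group \<G> I a G \<longleftrightarrow>
     (\<exists>((n, R), as) \<in> constrs I. \<exists>Gs. length Gs = n \<and> set Gs \<subseteq> \<G> \<and>
        R \<subseteq> carrier (DirProd_list Gs) \<and> (\<exists>i < n. as ! i = a \<and> Gs ! i = G))"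

definition cgroup :: "'t monoid set \<Rightarrow> ('t, 'e) inst \<Rightarrow> 'e \<Rightarrow> 't monoid" where
  "cgroup \<G> I a = (THE G. constraining_group \<G> I a G)"

text \<open>Non-contradictory instances over a coset template.\<close>

definition coset_inst :: "'t template \<Rightarrow> 't monoid set \<Rightarrow> ('t, 'e) inst \<Rightarrow> bool" where
  "coset_inst T \<G> I \<longleftrightarrow> inst_over T I \<and> (\<forall>a \<in> elems I. \<exists>!G. constraining_group \<G> I a G)"

text \<open>Pre-solutions are extensional functions (\<open>undefined\<close> outside \<open>elems I\<close>), so that they
  are exactly the carrier of a product group.\<close>

definition presol_group :: "'t monoid set \<Rightarrow> ('t, 'e) inst \<Rightarrow> ('e \<Rightarrow> 't) monoid" where
  "presol_group \<G> I = product_group (elems I) (cgroup \<G> I)"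

abbreviation presolutions :: "'t monoid set \<Rightarrow> ('t, 'e) inst \<Rightarrow> ('e \<Rightarrow> 't) set" where
  "presolutions \<G> I \<equiv> carrier (presol_group \<G> I)"

definition translate :: "'t monoid set \<Rightarrow> ('t, 'e) inst \<Rightarrow> ('e \<Rightarrow> 't) \<Rightarrow> ('t, 'e) inst" where
  "translate \<G> I s = \<lparr>elems = elems I,
     constrs = (\<lambda>((n, R), as).
       ((n, R #>\<^bsub>DirProd_list (map (cgroup \<G> I) as)\<^esub> map s as), as)) ` constrs I\<rparr>"

definition fixes_on :: "'t monoid set \<Rightarrow> ('t, 'e) inst \<Rightarrow> ('e \<Rightarrow> 't) \<Rightarrow> 'e set \<Rightarrow> bool" where
  "fixes_on \<G> I s S \<longleftrightarrow> (\<forall>x \<in> S. s x = \<one>\<^bsub>cgroup \<G> I x\<^esub>)"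

section \<open>Algorithms\<close>

text \<open>\<open>step A I [\<D>\<^sub>1(I), \<dots>, \<D>\<^sub>i\<^sub>-\<^sub>1(I)]\<close> is the object \<open>\<D>\<^sub>i(I)\<close>. The last object determines the
  outcome; in particular it tells that it is the last one: \<open>verdict A x\<close> is \<open>None\<close> if the
  computation continues after the object \<open>x\<close>, and otherwise the computation stops and accepts
  (\<open>Some True\<close>) or rejects (\<open>Some False\<close>). (If the number of stages could depend on the
  instance arbitrarily, it could itself encode solvability and locality would be void.)
  \<open>act A s x\<close> is $x \cdot s$.\<close>

record ('t, 'e, 'o) algorithm =
  step :: "('t, 'e) inst \<Rightarrow> 'o list \<Rightarrow> 'o"
  verdict :: "'o \<Rightarrow> bool option"
  act :: "('e \<Rightarrow> 't) \<Rightarrow> 'o \<Rightarrow> 'o"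

primrec history :: "('t, 'e, 'o) algorithm \<Rightarrow> ('t, 'e) inst \<Rightarrow> nat \<Rightarrow> 'o list" where
  "history A I 0 = []"
| "history A I (Suc i) = history A I i @ [step A I (history A I i)]"

text \<open>The \<open>i\<close>-th object; meaningful for \<open>1 \<le> i \<le> stages A I\<close>.\<close>

definition obj :: "('t, 'e, 'o) algorithm \<Rightarrow> ('t, 'e) inst \<Rightarrow> nat \<Rightarrow> 'o" where
  "obj A I i = step A I (history A I (i - 1))"

definition terminates :: "('t, 'e, 'o) algorithm \<Rightarrow> ('t, 'e) inst \<Rightarrow> bool" where
  "terminates A I \<longleftrightarrow> (\<exists>i \<ge> 1. verdict A (obj A I i) \<noteq> None)"

definition stages :: "('t, 'e, 'o) algorithm \<Rightarrow> ('t, 'e) inst \<Rightarrow> nat" where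
  "stages A I = (LEAST i. i \<ge> 1 \<and> verdict A (obj A I i) \<noteq> None)"

definition accepts :: "('t, 'e, 'o) algorithm \<Rightarrow> ('t, 'e) inst \<Rightarrow> bool" where
  "accepts A I \<longleftrightarrow> verdict A (obj A I (stages A I)) = Some True"

text \<open>The action of the pre-solutions is a right action, in accordance with
  $I \cdot (s s') = (I \cdot s) \cdot s'$.\<close>

definition coset_algorithm ::
    "'t template \<Rightarrow> 't monoid set \<Rightarrow> ('t, 'e, 'o) algorithm \<Rightarrow> bool" where
  "coset_algorithm T \<G> A \<longleftrightarrow> (\<forall>I. coset_inst T \<G> I \<longrightarrow>
     terminates A I \<and>
     (\<forall>x. act A \<one>\<^bsub>presol_group \<G> I\<^esub> x = x) \<and>
     (\<forall>s \<in> presolutions \<G> I. \<forall>s' \<in> presolutions \<G> I. \<forall>x.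
        act A (s \<otimes>\<^bsub>presol_group \<G> I\<^esub> s') x = act A s' (act A s x)))"

definition equivariant ::
    "'t template \<Rightarrow> 't monoid set \<Rightarrow> ('t, 'e, 'o) algorithm \<Rightarrow> bool" where
  "equivariant T \<G> A \<longleftrightarrow> (\<forall>I. coset_inst T \<G> I \<longrightarrow> (\<forall>s \<in> presolutions \<G> I.
     stages A (translate \<G> I s) = stages A I \<and>
     (\<forall>i \<in> {1..stages A I}. obj A (translate \<G> I s) i = act A s (obj A I i))))"

text \<open>``Depends only on'' means: any other run of the algorithm that agrees on the given data
  yields the same \<open>i\<close>-th object. Only runs on instances with the same set of elements are
  compared, because which part of the input the stage with number \<open>i\<close> is concerned with may
  depend on the set of elements (e.g. if the stages range over the subsets of bounded size).\<close>

definition comparable_run ::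
    "'t template \<Rightarrow> 't monoid set \<Rightarrow> ('t, 'e, 'o) algorithm \<Rightarrow> ('t, 'e) inst \<Rightarrow> nat \<Rightarrow>
     ('t, 'e) inst \<Rightarrow> bool" where
  "comparable_run T \<G> A I i I' \<longleftrightarrow>
     coset_inst T \<G> I' \<and> elems I' = elems I \<and> i \<le> stages A I'"

definition L0 ::
    "'t template \<Rightarrow> 't monoid set \<Rightarrow> ('t, 'e, 'o) algorithm \<Rightarrow> nat \<Rightarrow> ('t, 'e) inst \<Rightarrow> nat \<Rightarrow> bool"
  where
  "L0 T \<G> A d I i \<longleftrightarrow> (\<exists>S \<subseteq> elems I. card S \<le> d \<and>
     (\<forall>I'. comparable_run T \<G> A I i I' \<and> restrict_inst I' S = restrict_inst I S \<longrightarrow>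
        obj A I' i = obj A I i))"

definition L1 ::
    "'t template \<Rightarrow> 't monoid set \<Rightarrow> ('t, 'e, 'o) algorithm \<Rightarrow> nat \<Rightarrow> ('t, 'e) inst \<Rightarrow> nat \<Rightarrow> bool"
  where
  "L1 T \<G> A d I i \<longleftrightarrow> (\<exists>J \<subseteq> {1..<i}. card J \<le> d \<and>
     (\<forall>I'. comparable_run T \<G> A I i I' \<and> (\<forall>j \<in> J. obj A I' j = obj A I j) \<longrightarrow>
        obj A I' i = obj A I i))"

definition L2 ::
    "'t monoid set \<Rightarrow> ('t, 'e, 'o) algorithm \<Rightarrow> nat \<Rightarrow> ('t, 'e) inst \<Rightarrow> nat \<Rightarrow> bool" where
  "L2 \<G> A d I i \<longleftrightarrow> (\<exists>S \<subseteq> elems I. card S \<le> d \<and>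
     (\<forall>s \<in> presolutions \<G> I. fixes_on \<G> I s S \<longrightarrow> act A s (obj A I i) = obj A I i))"

definition local_equivariant ::
    "'t template \<Rightarrow> 't monoid set \<Rightarrow> ('t, 'e, 'o) algorithm \<Rightarrow> bool" where
  "local_equivariant T \<G> A \<longleftrightarrow> coset_algorithm T \<G> A \<and> equivariant T \<G> A \<and>
     (\<exists>d. \<forall>I. coset_inst T \<G> I \<longrightarrow> (\<forall>i \<in> {1..stages A I}.
        L0 T \<G> A d I i \<or> (L1 T \<G> A d I i \<and> L2 \<G> A d I i)))"

definition solves_CSP ::
    "'t template \<Rightarrow> 't monoid set \<Rightarrow> ('t, 'e, 'o) algorithm \<Rightarrow> bool" where
  "solves_CSP T \<G> A \<longleftrightarrow>
     (\<forall>I. coset_inst T \<G> I \<longrightarrow> (accepts A I \<longleftrightarrow> (\<exists>h. solution T I h)))"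

end

(*
  From an anomaly one extracts a subgroup P of a product of three carrier groups, definable by
  an instance, that contains (g,x,1) and (g,1,y) but not (g,1,1). Let M be the group of all m with
  (m,x,1) and (m,1,y) in P for some x and y, and N the group of all m with (m,1,1) in P. Taking
  commutators of such triples shows that N contains [M,M], so M/N is an abelian group, in which P
  expresses the equation a = b + c, and g represents a nonzero element.

  Copies of the instance therefore encode the linear system that requires every row and every
  column of an n x n matrix over M/N to sum to zero. It is solvable, but it becomes unsolvable if
  one column j is required to sum to g^-1 instead. Call the resulting instances I and I'_j. Apart
  from two constants, every element of the instance belongs to a single row or column. If a set S
  of elements avoids the columns j, j' and some row, then I'_j and I'_j' are translates of each
  other by a pre-solution that fixes S: move the charge through that row. By induction on the
  stage i, locality then gives a set S of at most d elements such that the i-th objects of I and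
  of I'_j agree for every column j that S avoids, provided that n > d + d^2. So the algorithm
  cannot distinguish I from all I'_j.
*)
theory Submission
  imports Defs "HOL-Library.Countable"
begin

section \<open>Lists over direct products\<close>

text \<open>With products written as \<open>DirProd_list (map \<gamma> as)\<close> and tuples as
  \<open>map s as\<close>, group operations on tuples become pointwise operations on functions of
  the elements.\<close>

lemma map_mem_DirProd_list:
  "map s as \<in> carrier (DirProd_list (map \<gamma> as)) \<longleftrightarrow> (\<forall>a \<in> set as. s a \<in> carrier (\<gamma> a))"
proof (induction as)
  case Nil
  then show ?case by (simp add: DirProd_list_def)
next
  case (Cons a as)
  then show ?case by (auto simp: DirProd_list_carrier image_iff)
qed

lemma mult_DirProd_list_map:
  assumes "\<forall>a \<in> set as. s a \<in> carrier (\<gamma> a)" "\<forall>a \<in> set as. t a \<in> carrier (\<gamma> a)"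
  shows "map s as \<otimes>\<^bsub>DirProd_list (map \<gamma> as)\<^esub> map t as = map (\<lambda>a. s a \<otimes>\<^bsub>\<gamma> a\<^esub> t a) as"
  using assms
proof (induction as)
  case Nil
  then show ?case by (simp add: DirProd_list_def)
next
  case (Cons a as)
  let ?P = "DirProd_list (map \<gamma> as)"
  have "(\<lambda>(g, gs). g # gs) \<in> hom (\<gamma> a \<times>\<times> ?P) (DirProd_list (\<gamma> a # map \<gamma> as))"
    using DirProd_list_iso by (auto simp: iso_def)
  from hom_mult[OF this, of "(s a, map s as)" "(t a, map t as)"]
  show ?case using Cons by (simp add: map_mem_DirProd_list)
qed

lemma one_DirProd_list_map: "\<one>\<^bsub>DirProd_list (map \<gamma> as)\<^esub> = map (\<lambda>a. \<one>\<^bsub>\<gamma> a\<^esub>) as"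
  by (induction as) (auto simp: DirProd_list_one)

lemma group_DirProd_list_map:
  "(\<forall>a \<in> set as. group (\<gamma> a)) \<Longrightarrow> group (DirProd_list (map \<gamma> as))"
  by (rule DirProd_list_is_group) auto

lemma inv_DirProd_list_map:
  assumes "\<forall>a \<in> set as. group (\<gamma> a)" "\<forall>a \<in> set as. s a \<in> carrier (\<gamma> a)"
  shows "inv\<^bsub>DirProd_list (map \<gamma> as)\<^esub> map s as = map (\<lambda>a. inv\<^bsub>\<gamma> a\<^esub> s a) as"
proof (rule group.inv_equality[OF group_DirProd_list_map[OF assms(1)]])
  show "map (\<lambda>a. inv\<^bsub>\<gamma> a\<^esub> s a) as \<otimes>\<^bsub>DirProd_list (map \<gamma> as)\<^esub> map s as =
      \<one>\<^bsub>DirProd_list (map \<gamma> as)\<^esub>"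
    using assms by (subst mult_DirProd_list_map) (auto simp: one_DirProd_list_map group.l_inv)
qed (use assms in \<open>auto simp: map_mem_DirProd_list\<close>)

section \<open>Instances given by typed constraints\<close>

definition inst_of :: "('t relation \<times> 'e list) set \<Rightarrow> ('t, 'e) inst" where
  "inst_of Q = \<lparr>elems = (\<Union>(R, as) \<in> Q. set as), constrs = Q\<rparr>"

definition satisfies :: "('e \<Rightarrow> 't) \<Rightarrow> ('t relation \<times> 'e list) set \<Rightarrow> bool" where
  "satisfies f Q \<longleftrightarrow> (\<forall>((n, R), as) \<in> Q. map f as \<in> R)"

lemma satisfiesI: "(\<And>n R as. ((n, R), as) \<in> Q \<Longrightarrow> map f as \<in> R) \<Longrightarrow> satisfies f Q"
  and satisfiesD: "satisfies f Q \<Longrightarrow> ((n, R), as) \<in> Q \<Longrightarrow> map f as \<in> R"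
  unfolding satisfies_def by fast+

lemma satisfies_Un: "satisfies f (A \<union> B) \<longleftrightarrow> satisfies f A \<and> satisfies f B"
  unfolding satisfies_def by (rule ball_Un)

lemma satisfies_UN: "satisfies f (\<Union>k \<in> K. B k) \<longleftrightarrow> (\<forall>k \<in> K. satisfies f (B k))"
  unfolding satisfies_def by blast

lemma satisfies_map:
  "satisfies f ((\<lambda>(R, as). (R, map h as)) ` B) \<longleftrightarrow> satisfies (\<lambda>a. f (h a)) B"
  unfolding satisfies_def by (simp add: case_prod_beta comp_def)

lemma satisfies_singletons:
  "satisfies f ((\<lambda>b. ((1, {[x b]}), [y b])) ` B) \<longleftrightarrow> (\<forall>b \<in> B. f (y b) = x b)"
  unfolding satisfies_def by simp

text \<open>\<open>\<gamma>\<close> is total, so the constraining groups are given by an explicit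
  function instead of a definite description.\<close>

definition typed ::
    "'t template \<Rightarrow> 't monoid set \<Rightarrow> ('e \<Rightarrow> 't monoid) \<Rightarrow> ('t relation \<times> 'e list) set \<Rightarrow> bool" where
  "typed T \<G> \<gamma> Q \<longleftrightarrow> finite Q \<and> range \<gamma> \<subseteq> \<G> \<and>
     (\<forall>((n, R), as) \<in> Q. (n, R) \<in> trels T \<and> length as = n \<and> R \<subseteq> carrier (DirProd_list (map \<gamma> as)))"

lemma typedI:
  assumes "finite Q" "range \<gamma> \<subseteq> \<G>"
    "\<And>n R as. ((n, R), as) \<in> Q \<Longrightarrow>
      (n, R) \<in> trels T \<and> length as = n \<and> R \<subseteq> carrier (DirProd_list (map \<gamma> as))"
  shows "typed T \<G> \<gamma> Q"
  using assms unfolding typed_def by fast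

text \<open>The effect of \<open>translate\<close> on one constraint, with the groups taken from
  \<open>\<gamma>\<close> and without asking \<open>s\<close> to be extensional.\<close>

definition shift ::
    "('e \<Rightarrow> 't monoid) \<Rightarrow> ('e \<Rightarrow> 't) \<Rightarrow> ('t relation \<times> 'e list) \<Rightarrow> ('t relation \<times> 'e list)" where
  "shift \<gamma> s = (\<lambda>((n, R), as). ((n, R #>\<^bsub>DirProd_list (map \<gamma> as)\<^esub> map s as), as))"

lemma elems_inst_of: "elems (inst_of Q) = (\<Union>(R, as) \<in> Q. set as)"
  and constrs_inst_of [simp]: "constrs (inst_of Q) = Q"
  by (auto simp: inst_of_def)

section \<open>Groups, cosets and translates of the relations of a coset template\<close>

locale coset_tmpl =
  fixes T :: "'t template" and \<G> :: "'t monoid set"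
  assumes coset_template: "coset_template T \<G>"
begin

lemma group_carrier: "G \<in> \<G> \<Longrightarrow> group G"
  using coset_template by (auto simp: coset_template_def)

lemma carrier_group_unique:
  "G \<in> \<G> \<Longrightarrow> H \<in> \<G> \<Longrightarrow> x \<in> carrier G \<Longrightarrow> x \<in> carrier H \<Longrightarrow> G = H"
  using coset_template unfolding coset_template_def by blast

lemma mem_carrier_group: "x \<in> tcarrier T \<Longrightarrow> \<exists>G \<in> \<G>. x \<in> carrier G"
  using coset_template by (auto simp: coset_template_def)

lemma template: "template T"
  using coset_template by (simp only: coset_template_def)

lemma relation_coset:
  assumes "(n, R) \<in> trels T"
  obtains Gs H where "length Gs = n" "set Gs \<subseteq> \<G>" "subgroup H (DirProd_list Gs)"
    "R \<in> rcosets\<^bsub>DirProd_list Gs\<^esub> H" "group (DirProd_list Gs)" "R \<subseteq> carrier (DirProd_list Gs)" "R \<noteq> {}"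
proof -
  have *: "\<forall>(n, R) \<in> trels T. \<exists>Gs H. length Gs = n \<and> set Gs \<subseteq> \<G> \<and>
        subgroup H (DirProd_list Gs) \<and> R \<in> rcosets\<^bsub>DirProd_list Gs\<^esub> H"
    using coset_template unfolding coset_template_def by (elim conjE)
  then obtain Gs H where Gs: "length Gs = n" "set Gs \<subseteq> \<G>" and H: "subgroup H (DirProd_list Gs)"
    and R: "R \<in> rcosets\<^bsub>DirProd_list Gs\<^esub> H"
    using bspec[OF * assms] by auto
  have grp: "group (DirProd_list Gs)"
    by (rule DirProd_list_is_group) (metis Gs(2) group_carrier nth_mem subsetD)
  show thesis
    by (rule that[OF Gs H R grp subgroup.rcosets_carrier[OF H grp R] subgroup.rcosets_non_empty[OF H R]])
qed

text \<open>Distinct carrier groups are disjoint, so each entry of the single tuple \<open>t\<close>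
  determines the group at its position.\<close>

lemma relation_group_unique:
  assumes "(n, R) \<in> trels T" "length Gs = n" "set Gs \<subseteq> \<G>" "length Hs = n" "set Hs \<subseteq> \<G>"
    "t \<in> carrier (DirProd_list Gs)" "t \<in> carrier (DirProd_list Hs)"
  shows "Gs = Hs"
proof (rule nth_equalityI)
  fix i assume "i < length Gs"
  then show "Gs ! i = Hs ! i"
    using assms carrier_group_unique[of "Gs ! i" "Hs ! i" "t ! i"]
      DirProd_list_carrier_mem(2)[OF assms(6), of i] DirProd_list_carrier_mem(2)[OF assms(7), of i]
    by (metis nth_mem subsetD)
qed (use assms in auto)

lemma relation_translate:
  assumes "(n, R) \<in> trels T" "length Gs = n" "set Gs \<subseteq> \<G>" "R \<subseteq> carrier (DirProd_list Gs)"
    "\<pi> \<in> carrier (DirProd_list Gs)"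
  shows "(n, R #>\<^bsub>DirProd_list Gs\<^esub> \<pi>) \<in> trels T"
proof -
  have *: "\<forall>(n, R) \<in> trels T. \<forall>Gs. length Gs = n \<and> set Gs \<subseteq> \<G> \<and> R \<subseteq> carrier (DirProd_list Gs) \<longrightarrow>
        (\<forall>\<pi> \<in> carrier (DirProd_list Gs). (n, R #>\<^bsub>DirProd_list Gs\<^esub> \<pi>) \<in> trels T)"
    using coset_template unfolding coset_template_def by (elim conjE)
  show ?thesis using bspec[OF * assms(1), unfolded prod.case] assms(2-) by blast
qed

lemma relation_one: "G \<in> \<G> \<Longrightarrow> (1, {[\<one>\<^bsub>G\<^esub>]}) \<in> trels T"
  using coset_template unfolding coset_template_def by (elim conjE) (rule bspec)

text \<open>A relation is a coset and hence nonempty; any of its tuples determines the groups at all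
  positions, which are therefore those given by \<open>\<gamma>\<close>.\<close>

lemma constraining_group_inst_of:
  assumes ty: "typed T \<G> \<gamma> Q" and a: "a \<in> elems (inst_of Q)"
  shows "constraining_group \<G> (inst_of Q) a G \<longleftrightarrow> G = \<gamma> a"
proof
  assume "constraining_group \<G> (inst_of Q) a G"
  then obtain n R as Gs i where c: "((n, R), as) \<in> Q" "length Gs = n" "set Gs \<subseteq> \<G>"
      "R \<subseteq> carrier (DirProd_list Gs)" "i < n" "as ! i = a" "Gs ! i = G"
    unfolding constraining_group_def by fastforce
  then have t: "(n, R) \<in> trels T" "length as = n" "R \<subseteq> carrier (DirProd_list (map \<gamma> as))"
    "range \<gamma> \<subseteq> \<G>"
    using ty by (auto simp: typed_def)
  obtain t where "t \<in> R" using relation_coset[OF t(1)] by blast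
  then have "Gs = map \<gamma> as"
    using c t by (intro relation_group_unique[OF t(1), of Gs "map \<gamma> as" t]) auto
  then show "G = \<gamma> a" using c t by auto
next
  assume G: "G = \<gamma> a"
  obtain n R as where c: "((n, R), as) \<in> Q" "a \<in> set as" using a by (auto simp: elems_inst_of)
  then obtain i where "i < length as" "as ! i = a" by (auto simp: in_set_conv_nth)
  moreover have "length as = n" "set (map \<gamma> as) \<subseteq> \<G>" "R \<subseteq> carrier (DirProd_list (map \<gamma> as))"
    using c ty by (auto simp: typed_def)
  ultimately have "length (map \<gamma> as) = n \<and> set (map \<gamma> as) \<subseteq> \<G> \<and>
      R \<subseteq> carrier (DirProd_list (map \<gamma> as)) \<and> (\<exists>i < n. as ! i = a \<and> map \<gamma> as ! i = G)"
    using G by auto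
  then show "constraining_group \<G> (inst_of Q) a G"
    using c(1) unfolding constraining_group_def constrs_inst_of
    by (intro bexI[of _ "((n, R), as)"]) blast+
qed

lemma cgroup_inst_of: "typed T \<G> \<gamma> Q \<Longrightarrow> a \<in> elems (inst_of Q) \<Longrightarrow> cgroup \<G> (inst_of Q) a = \<gamma> a"
  by (simp add: cgroup_def constraining_group_inst_of)

lemma coset_inst_inst_of:
  assumes "typed T \<G> \<gamma> Q"
  shows "coset_inst T \<G> (inst_of Q)"
proof -
  have "inst_over T (inst_of Q)"
    using assms by (fastforce simp: inst_over_def typed_def elems_inst_of)
  then show ?thesis using constraining_group_inst_of[OF assms] by (auto simp: coset_inst_def)
qed

lemma presolutions_inst_of:
  assumes "typed T \<G> \<gamma> Q"
  shows "presolutions \<G> (inst_of Q) = (\<Pi>\<^sub>E a \<in> elems (inst_of Q). carrier (\<gamma> a))"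
  unfolding presol_group_def using cgroup_inst_of[OF assms] by (auto intro!: PiE_cong)

text \<open>In the application \<open>s'\<close> is the extensional restriction of \<open>s\<close>,
  as required of a pre-solution.\<close>

lemma translate_inst_of:
  assumes "typed T \<G> \<gamma> Q" "\<forall>a \<in> elems (inst_of Q). s' a = s a"
  shows "translate \<G> (inst_of Q) s' = inst_of (shift \<gamma> s ` Q)"
proof -
  have *: "map (cgroup \<G> (inst_of Q)) as = map \<gamma> as" "map s' as = map s as" if "(R, as) \<in> Q" for R as
    using cgroup_inst_of[OF assms(1)] assms(2) that by (auto simp: elems_inst_of)
  have "constrs (translate \<G> (inst_of Q) s') = shift \<gamma> s ` Q"
    unfolding translate_def shift_def inst.simps constrs_inst_of
    by (rule image_cong[OF refl]) (auto simp only: * split: prod.splits)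
  moreover have "elems (inst_of (shift \<gamma> s ` Q)) = elems (inst_of Q)"
    by (auto simp: elems_inst_of shift_def)
  ultimately show ?thesis by (simp add: inst_of_def translate_def)
qed

text \<open>Every element occurs in some constraint, whose relation forces its value into the
  carrier. Total functions without a range condition thus capture solvability.\<close>

lemma ex_solution_inst_of:
  assumes "typed T \<G> \<gamma> Q"
  shows "(\<exists>h. solution T (inst_of Q) h) \<longleftrightarrow> (\<exists>f. satisfies f Q)"
proof
  assume "\<exists>h. solution T (inst_of Q) h"
  then obtain h where "solution T (inst_of Q) h" ..
  then have "satisfies (\<lambda>a. the (h a)) Q"
    by (fastforce simp: solution_def partial_solution_def satisfies_def elems_inst_of)
  then show "\<exists>f. satisfies f Q" by blast
next
  assume "\<exists>f. satisfies f Q"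
  then obtain f where f: "satisfies f Q" ..
  define h where "h = (\<lambda>a. if a \<in> elems (inst_of Q) then Some (f a) else None)"
  have "map (\<lambda>a. the (h a)) as = map f as" if "(R, as) \<in> Q" for R as
    using that by (auto simp: h_def elems_inst_of)
  moreover have "f a \<in> tcarrier T" if "a \<in> elems (inst_of Q)" for a
  proof -
    obtain n R as where c: "((n, R), as) \<in> Q" "a \<in> set as" using \<open>a \<in> _\<close> by (auto simp: elems_inst_of)
    then have "(n, R) \<in> trels T" "map f as \<in> R" using assms f by (auto simp: typed_def satisfies_def)
    moreover have "\<forall>(n, R) \<in> trels T. \<forall>t \<in> R. length t = n \<and> set t \<subseteq> tcarrier T"
      using template unfolding template_def by blast
    ultimately have "set (map f as) \<subseteq> tcarrier T" by fast
    then show ?thesis using c(2) by auto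
  qed
  moreover have "map (\<lambda>a. the (h a)) as \<in> R" if "((n, R), as) \<in> Q" for n R as
    using satisfiesD[OF f that] calculation(1)[OF that] by (simp only:)
  moreover have "dom h = elems (inst_of Q)" by (auto simp: h_def split: if_splits)
  moreover have "ran h = f ` elems (inst_of Q)" by (auto simp: h_def ran_def)
  ultimately have "solution T (inst_of Q) h"
    unfolding solution_def partial_solution_def constrs_inst_of by (auto split: prod.splits)
  then show "\<exists>h. solution T (inst_of Q) h" by blast
qed

end

section \<open>Indistinguishable instances\<close>

lemma stages_least:
  assumes "terminates A I"
  shows "stages A I \<ge> 1" "verdict A (obj A I (stages A I)) \<noteq> None"
    "\<And>l. 1 \<le> l \<Longrightarrow> l < stages A I \<Longrightarrow> verdict A (obj A I l) = None"
proof -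
  have ex: "\<exists>i. i \<ge> 1 \<and> verdict A (obj A I i) \<noteq> None"
    using assms by (auto simp: terminates_def)
  from LeastI_ex[OF ex] show "stages A I \<ge> 1" "verdict A (obj A I (stages A I)) \<noteq> None"
    by (auto simp: stages_def)
  show "verdict A (obj A I l) = None" if "1 \<le> l" "l < stages A I" for l
    using not_less_Least[of l "\<lambda>i. i \<ge> 1 \<and> verdict A (obj A I i) \<noteq> None"] that
    by (auto simp: stages_def)
qed

text \<open>\<open>free S\<close> is the set of the indices \<open>j\<close> for which the set \<open>S\<close> does not reveal the
  difference between \<open>I\<close> and \<open>I' j\<close>. It plays the role of a tangle: the instances \<open>I' j\<close> with
  \<open>j \<in> free S\<close> are translates of each other by pre-solutions that fix \<open>S\<close>.\<close>

locale confusable =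
  fixes T :: "'t template" and \<G> :: "'t monoid set" and A :: "('t, 'e, 'o) algorithm"
    and d :: nat and I :: "('t, 'e) inst" and I' :: "'j \<Rightarrow> ('t, 'e) inst"
    and free :: "'e set \<Rightarrow> 'j set"
  assumes algorithm: "coset_algorithm T \<G> A" and equivariant: "equivariant T \<G> A"
    and local: "\<And>i. i \<in> {1..stages A I} \<Longrightarrow> L0 T \<G> A d I i \<or> (L1 T \<G> A d I i \<and> L2 \<G> A d I i)"
    and I: "coset_inst T \<G> I" and I': "\<And>j. coset_inst T \<G> (I' j)"
    and elems: "\<And>j. elems (I' j) = elems I"
    and presolutions: "\<And>j. presolutions \<G> (I' j) = presolutions \<G> I"
    and free_mono: "\<And>S S'. S \<subseteq> S' \<Longrightarrow> free S' \<subseteq> free S"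
    and free_nonempty: "\<And>S. finite S \<Longrightarrow> card S \<le> d + d * d \<Longrightarrow> free S \<noteq> {}"
    and restrict: "\<And>S j. j \<in> free S \<Longrightarrow> restrict_inst (I' j) S = restrict_inst I S"
    and translate: "\<And>S j j'. S \<subseteq> elems I \<Longrightarrow> card S \<le> d \<Longrightarrow> j \<in> free S \<Longrightarrow> j' \<in> free S \<Longrightarrow> j \<noteq> j' \<Longrightarrow>
      \<exists>s \<in> presolutions \<G> I. fixes_on \<G> I s S \<and> translate \<G> (I' j) s = I' j'"
begin

lemma finite_elems: "S \<subseteq> elems I \<Longrightarrow> finite S"
  using I by (auto simp: coset_inst_def inst_over_def intro: finite_subset)

lemma terminates: "terminates A I" "terminates A (I' j)"
  using algorithm I I' by (auto simp: coset_algorithm_def)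

lemma translate_obj:
  assumes "S \<subseteq> elems I" "card S \<le> d" "j \<in> free S" "j' \<in> free S" "j \<noteq> j'"
  obtains s where "s \<in> presolutions \<G> I" "fixes_on \<G> I s S" "stages A (I' j') = stages A (I' j)"
    "\<And>i. i \<in> {1..stages A (I' j)} \<Longrightarrow> obj A (I' j') i = act A s (obj A (I' j) i)"
proof -
  obtain s where s: "s \<in> presolutions \<G> I" "fixes_on \<G> I s S" "translate \<G> (I' j) s = I' j'"
    using translate[OF assms] by blast
  have "stages A (translate \<G> (I' j) s) = stages A (I' j) \<and>
     (\<forall>i \<in> {1..stages A (I' j)}. obj A (translate \<G> (I' j) s) i = act A s (obj A (I' j) i))"
    using equivariant[unfolded equivariant_def, THEN spec, THEN mp, OF I'] s(1)
    unfolding presolutions by (rule bspec)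
  then show thesis using that s by auto
qed

text \<open>Distinct instances of the family are translates of each other by the case of an empty
  fixed set, and equivariance preserves the number of stages.\<close>

lemma stages_eq:
  assumes "j \<in> free {}" "j' \<in> free {}"
  shows "stages A (I' j') = stages A (I' j)"
proof (cases "j = j'")
  case False
  then show ?thesis using translate_obj[of "{}" j j'] assms by auto
qed simp

text \<open>The invariant of the induction over stages: \<open>S\<close> is a set of bounded size
  such that stage \<open>i\<close> does not separate \<open>I\<close> from any \<open>I' j\<close>
  with \<open>j\<close> free for \<open>S\<close>.\<close>

definition agree :: "nat \<Rightarrow> 'e set \<Rightarrow> bool" where
  "agree i S \<longleftrightarrow> S \<subseteq> elems I \<and> card S \<le> d \<and> (\<forall>j \<in> free S. obj A (I' j) i = obj A I i)"

lemma agree_free: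
  assumes "agree i S"
  obtains j where "j \<in> free S" "j \<in> free {}" "obj A (I' j) i = obj A I i"
proof -
  have "free S \<noteq> {}" using assms free_nonempty[of S] finite_elems by (auto simp: agree_def)
  then show thesis using that assms free_mono[of "{}" S] by (auto simp: agree_def)
qed

text \<open>Locality only compares runs that reach stage \<open>i\<close>. If \<open>I' j\<close>
  stopped earlier, so would all of the family with index in \<open>free {}\<close>; one of them
  shares its last object with \<open>I\<close>, which has not stopped yet at that stage.\<close>

lemma stages_ge:
  assumes "\<And>l. l \<in> {1..<i} \<Longrightarrow> \<exists>S. agree l S" "i \<le> stages A I" "j \<in> free {}"
  shows "i \<le> stages A (I' j)"
proof (rule ccontr)
  let ?N = "stages A (I' j)"
  assume "\<not> i \<le> ?N"
  then have N: "?N \<in> {1..<i}" using stages_least(1)[OF terminates(2)] by auto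
  then obtain S where "agree ?N S" using assms(1) by blast
  then obtain j' where j': "j' \<in> free {}" "obj A (I' j') ?N = obj A I ?N"
    using agree_free by blast
  have "verdict A (obj A (I' j') ?N) \<noteq> None"
    using stages_least(2)[OF terminates(2), of j'] stages_eq[OF assms(3) j'(1)] by simp
  moreover have "verdict A (obj A I ?N) = None"
    using stages_least(3)[OF terminates(1), of ?N] N assms(2) by auto
  ultimately show False using j' by simp
qed

text \<open>Under \<open>L0\<close> the given set works directly. Under \<open>L1\<close> and
  \<open>L2\<close>, the former yields agreement for one index \<open>j0\<close>, and the latter
  spreads it to all indices that are free for \<open>S\<close>.\<close>

lemma ex_agree: "i \<in> {1..stages A I} \<Longrightarrow> \<exists>S. agree i S"
proof (induction i rule: less_induct)
  case (less i)
  then have IH: "\<And>l. l \<in> {1..<i} \<Longrightarrow> \<exists>S. agree l S" by auto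
  have comparable: "comparable_run T \<G> A I i (I' j)" if "j \<in> free {}" for j
    using that stages_ge[OF IH] less.prems I' elems by (auto simp: comparable_run_def)
  from local[OF less.prems] show ?case
  proof (elim disjE conjE)
    assume "L0 T \<G> A d I i"
    then obtain S where S: "S \<subseteq> elems I" "card S \<le> d"
      "\<And>I'. comparable_run T \<G> A I i I' \<Longrightarrow> restrict_inst I' S = restrict_inst I S \<Longrightarrow> obj A I' i = obj A I i"
      unfolding L0_def by blast
    have "obj A (I' j) i = obj A I i" if "j \<in> free S" for j
      using S(3) comparable restrict that free_mono[of "{}" S] by blast
    then show ?thesis using S unfolding agree_def by blast
  next
    assume "L1 T \<G> A d I i" "L2 \<G> A d I i"
    then obtain J S where J: "J \<subseteq> {1..<i}" "card J \<le> d"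
        "\<And>I'. comparable_run T \<G> A I i I' \<Longrightarrow> \<forall>j \<in> J. obj A I' j = obj A I j \<Longrightarrow> obj A I' i = obj A I i"
      and S: "S \<subseteq> elems I" "card S \<le> d"
        "\<And>s. s \<in> presolutions \<G> I \<Longrightarrow> fixes_on \<G> I s S \<Longrightarrow> act A s (obj A I i) = obj A I i"
      unfolding L1_def L2_def by blast
    obtain R where R: "\<And>l. l \<in> J \<Longrightarrow> agree l (R l)" using IH J(1) by (metis subsetD)
    \<comment> \<open>\<open>U\<close> only serves to find \<open>j0\<close>, which is free for
      \<open>S\<close> and for all sets of the earlier objects in \<open>J\<close>. The set kept for
      stage \<open>i\<close> is \<open>S\<close> alone, so the bound \<open>d\<close> does not grow
      along the induction.\<close>
    define U where "U = S \<union> (\<Union>l \<in> J. R l)"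
    have finJ: "finite J" using J(1) finite_subset by blast
    have "card (\<Union>l \<in> J. R l) \<le> (\<Sum>l \<in> J. card (R l))" by (rule card_UN_le[OF finJ])
    also have "\<dots> \<le> card J * d" using R by (intro sum_bounded_above[THEN order_trans]) (auto simp: agree_def)
    also have "\<dots> \<le> d * d" using J(2) by simp
    finally have "card U \<le> d + d * d"
      unfolding U_def using card_Un_le[of S "\<Union>l \<in> J. R l"] S(2) by linarith
    moreover have "U \<subseteq> elems I" using S(1) R unfolding U_def agree_def by blast
    ultimately obtain j0 where j0: "j0 \<in> free U"
      using free_nonempty finite_elems by blast
    then have j0S: "j0 \<in> free S" "j0 \<in> free {}" and j0R: "\<And>l. l \<in> J \<Longrightarrow> j0 \<in> free (R l)"
      using free_mono[of S U] free_mono[of "{}" U] free_mono[of "R _" U] by (auto simp: U_def)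
    have base: "obj A (I' j0) i = obj A I i"
      using J(3)[OF comparable[OF j0S(2)]] R j0R by (auto simp: agree_def)
    \<comment> \<open>The translation from \<open>I' j0\<close> to \<open>I' j\<close> fixes
      \<open>S\<close>; by \<open>L2\<close> it leaves the common object of \<open>I\<close> and
      \<open>I' j0\<close> unchanged.\<close>
    have "obj A (I' j) i = obj A I i" if j: "j \<in> free S" for j
    proof (cases "j0 = j")
      case False
      obtain s where s: "s \<in> presolutions \<G> I" "fixes_on \<G> I s S"
          "\<And>i. i \<in> {1..stages A (I' j0)} \<Longrightarrow> obj A (I' j) i = act A s (obj A (I' j0) i)"
        using translate_obj[OF S(1,2) j0S(1) j False] by metis
      have "i \<in> {1..stages A (I' j0)}"
        using less.prems comparable[OF j0S(2)] by (auto simp: comparable_run_def)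
      then show ?thesis using s(3) base S(3)[OF s(1,2)] by simp
    qed (use base in auto)
    then show ?thesis using S unfolding agree_def by blast
  qed
qed

text \<open>The last object of \<open>I\<close> is shared by some \<open>I' j\<close>. As it carries
  a verdict, \<open>I' j\<close> stops there too, and not before by
  \<open>stages_ge\<close>.\<close>

theorem accepts_eq: "\<exists>j \<in> free {}. accepts A (I' j) \<longleftrightarrow> accepts A I"
proof -
  let ?n = "stages A I"
  have n: "?n \<ge> 1" using stages_least(1)[OF terminates(1)] .
  then obtain S where "agree ?n S" using ex_agree[of ?n] by auto
  then obtain j where j: "j \<in> free {}" "obj A (I' j) ?n = obj A I ?n" using agree_free by blast
  have "?n \<le> stages A (I' j)" using stages_ge[of ?n j] ex_agree j by auto
  moreover have "verdict A (obj A (I' j) ?n) \<noteq> None"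
    using stages_least(2)[OF terminates(1)] j by simp
  ultimately have "stages A (I' j) = ?n"
    using stages_least(3)[OF terminates(2), of ?n j] n by force
  then have "accepts A (I' j) \<longleftrightarrow> accepts A I" using j by (simp add: accepts_def)
  then show ?thesis using j(1) ..
qed

end

section \<open>Double counting in an abelian group\<close>

text \<open>\<open>Z\<close> and \<open>Y\<close> are partial products of \<open>U\<close> along
  rows and columns. Each row has product one, so the product of the \<open>Y i j\<close> over
  \<open>j\<close> does not change with \<open>i\<close>, and it is one for
  \<open>i = n\<close>.\<close>

lemma (in comm_group) grid_product:
  fixes U Y Z :: "nat \<Rightarrow> nat \<Rightarrow> 'a"
  assumes carr: "\<And>i j. U i j \<in> carrier G" "\<And>i j. Y i j \<in> carrier G" "\<And>i j. Z i j \<in> carrier G"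
    and Y: "\<And>i j. i < n \<Longrightarrow> j < n \<Longrightarrow> Y (Suc i) j = Y i j \<otimes> U i j"
    and Z: "\<And>i j. i < n \<Longrightarrow> j < n \<Longrightarrow> Z i (Suc j) = Z i j \<otimes> U i j"
    and "\<And>i. i < n \<Longrightarrow> Z i 0 = \<one>" "\<And>i. i < n \<Longrightarrow> Z i n = \<one>" "\<And>j. j < n \<Longrightarrow> Y n j = \<one>"
  shows "(\<Otimes>j\<in>{..<n}. Y 0 j) = \<one>"
proof -
  have row: "(\<Otimes>j\<in>{..<l}. U i j) = Z i l" if "i < n" "l \<le> n" for i l
    using that
  proof (induction l)
    case (Suc l)
    then show ?case using assms by (simp add: lessThan_Suc m_comm)
  qed (use assms in auto)
  have "(\<Otimes>j\<in>{..<n}. Y l j) = (\<Otimes>j\<in>{..<n}. Y 0 j)" if "l \<le> n" for l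
    using that
  proof (induction l)
    case (Suc l)
    then have "(\<Otimes>j\<in>{..<n}. Y (Suc l) j) = (\<Otimes>j\<in>{..<n}. Y l j \<otimes> U l j)"
      using Y carr by (intro finprod_cong') auto
    also have "\<dots> = (\<Otimes>j\<in>{..<n}. Y l j) \<otimes> (\<Otimes>j\<in>{..<n}. U l j)"
      using carr by (intro finprod_multf) auto
    finally show ?case using Suc row[of l n] assms by simp
  qed simp
  from this[of n] have "(\<Otimes>j\<in>{..<n}. Y 0 j) = (\<Otimes>j\<in>{..<n}. Y n j)" by simp
  also have "\<dots> = (\<Otimes>j\<in>{..<n}. \<one>)" using assms by (intro finprod_cong') auto
  finally show ?thesis by simp
qed

section \<open>Gadgets\<close>

text \<open>An anomaly after translation to subgroups: \<open>p\<close> and \<open>q\<close> are the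
  triples $(g,x,1)$ and $(g,1,y)$ with the same $g$, and the last assumption excludes $(g,1,1)$.
  Their values lie in the groups even at points outside \<open>Q\<close>, so that their powers do as
  well.\<close>

locale gadget = coset_tmpl T \<G> for T :: "'t template" and \<G> +
  fixes \<gamma> :: "'a \<Rightarrow> 't monoid" and Q :: "('t relation \<times> 'a list) set"
    and a0 a1 a2 :: 'a and p q :: "'a \<Rightarrow> 't"
  assumes \<gamma>: "\<gamma> a \<in> \<G>" and finite_Q: "finite Q"
    and rel: "((n, R), as) \<in> Q \<Longrightarrow> (n, R) \<in> trels T \<and> length as = n \<and> subgroup R (DirProd_list (map \<gamma> as))"
    and distinct: "a0 \<noteq> a1" "a0 \<noteq> a2" "a1 \<noteq> a2"
    and p: "satisfies p Q" "p a \<in> carrier (\<gamma> a)" "p a2 = \<one>\<^bsub>\<gamma> a2\<^esub>"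
    and q: "satisfies q Q" "q a \<in> carrier (\<gamma> a)" "q a1 = \<one>\<^bsub>\<gamma> a1\<^esub>" "q a0 = p a0"
    and no_solution: "\<not> (\<exists>r. satisfies r Q \<and> r a0 = p a0 \<and> r a1 = \<one>\<^bsub>\<gamma> a1\<^esub> \<and> r a2 = \<one>\<^bsub>\<gamma> a2\<^esub>)"
begin

abbreviation "g \<equiv> p a0"

lemma group_\<gamma> [simp]: "group (\<gamma> a)"
  using \<gamma> group_carrier by blast

lemma typed_Q: "typed T \<G> \<gamma> Q"
  using \<gamma> finite_Q rel subgroup.subset by (fastforce simp: typed_def)

lemma satisfies_carrier: "satisfies r Q \<Longrightarrow> a \<in> elems (inst_of Q) \<Longrightarrow> r a \<in> carrier (\<gamma> a)"
  using typed_Q map_mem_DirProd_list[where \<gamma> = \<gamma> and s = r] by (fastforce simp: satisfies_def typed_def elems_inst_of)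

section \<open>The group of satisfying assignments\<close>

lemma satisfies_one: "satisfies (\<lambda>a. \<one>\<^bsub>\<gamma> a\<^esub>) Q"
proof (rule satisfiesI)
  fix n R as assume "((n, R), as) \<in> Q"
  then show "map (\<lambda>a. \<one>\<^bsub>\<gamma> a\<^esub>) as \<in> R"
    using subgroup.one_closed[of R "DirProd_list (map \<gamma> as)"] rel
    by (simp add: one_DirProd_list_map)
qed

lemma satisfies_mult:
  assumes "satisfies r Q" "satisfies s Q"
  shows "satisfies (\<lambda>a. r a \<otimes>\<^bsub>\<gamma> a\<^esub> s a) Q"
proof (rule satisfiesI)
  fix n R as assume c: "((n, R), as) \<in> Q"
  then have "\<forall>a \<in> set as. a \<in> elems (inst_of Q)" by (auto simp: elems_inst_of)
  then have "\<forall>a \<in> set as. r a \<in> carrier (\<gamma> a)" "\<forall>a \<in> set as. s a \<in> carrier (\<gamma> a)"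
    using assms[THEN satisfies_carrier] by auto
  moreover have "map r as \<in> R" "map s as \<in> R" using assms[THEN satisfiesD, OF c] .
  ultimately show "map (\<lambda>a. r a \<otimes>\<^bsub>\<gamma> a\<^esub> s a) as \<in> R"
    using subgroup.m_closed[of R "DirProd_list (map \<gamma> as)" "map r as" "map s as"] rel[OF c]
    by (simp add: mult_DirProd_list_map)
qed

lemma satisfies_inv:
  assumes "satisfies r Q"
  shows "satisfies (\<lambda>a. inv\<^bsub>\<gamma> a\<^esub> r a) Q"
proof (rule satisfiesI)
  fix n R as assume c: "((n, R), as) \<in> Q"
  then have "\<forall>a \<in> set as. a \<in> elems (inst_of Q)" by (auto simp: elems_inst_of)
  then have "\<forall>a \<in> set as. r a \<in> carrier (\<gamma> a)"
    using satisfies_carrier[OF assms] by auto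
  moreover have "map r as \<in> R" using satisfiesD[OF assms c] .
  ultimately show "map (\<lambda>a. inv\<^bsub>\<gamma> a\<^esub> r a) as \<in> R"
    using subgroup.m_inv_closed[of R "DirProd_list (map \<gamma> as)" "map r as"] rel[OF c]
    by (simp add: inv_DirProd_list_map)
qed

lemma satisfies_int_pow:
  assumes "satisfies r Q"
  shows "satisfies (\<lambda>a. r a [^]\<^bsub>\<gamma> a\<^esub> (k::int)) Q"
proof -
  have nat: "satisfies (\<lambda>a. r a [^]\<^bsub>\<gamma> a\<^esub> (k::nat)) Q" for k
  proof (induction k)
    case 0
    then show ?case using satisfies_one by simp
  next
    case (Suc k)
    then show ?case using satisfies_mult[OF Suc assms] by simp
  qed
  have "(\<lambda>a. r a [^]\<^bsub>\<gamma> a\<^esub> k) =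
      (if k < 0 then (\<lambda>a. inv\<^bsub>\<gamma> a\<^esub> (r a [^]\<^bsub>\<gamma> a\<^esub> nat (- k)))
       else (\<lambda>a. r a [^]\<^bsub>\<gamma> a\<^esub> nat k))"
    by (cases "k < 0") (simp_all only: int_pow_def2 if_True if_False)
  then show ?thesis
    using nat[of "nat k"] satisfies_inv[OF nat[of "nat (- k)"]] by (cases "k < 0") (simp_all only: if_True if_False)
qed

section \<open>The ternary relation defined by the gadget and the abelian quotient\<close>

lemma no_extension:
  "satisfies r Q \<Longrightarrow> r a0 = g \<Longrightarrow> r a1 = \<one>\<^bsub>\<gamma> a1\<^esub> \<Longrightarrow> r a2 = \<one>\<^bsub>\<gamma> a2\<^esub> \<Longrightarrow> False"
  using no_solution by blast

text \<open>The value at a point outside all constraints can be changed freely. If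
  \<open>a0\<close>, \<open>a1\<close> or \<open>a2\<close> were such a point, one change would turn
  the identity, \<open>p\<close> or \<open>q\<close>, respectively, into the excluded
  triple.\<close>

lemma mem_elems: "a0 \<in> elems (inst_of Q)" "a1 \<in> elems (inst_of Q)" "a2 \<in> elems (inst_of Q)"
proof -
  have upd: "satisfies (r(a := x)) Q" if "satisfies r Q" "a \<notin> elems (inst_of Q)" for r a x
  proof (rule satisfiesI)
    fix n R as assume c: "((n, R), as) \<in> Q"
    then have "a \<notin> set as" using that by (auto simp: elems_inst_of)
    then show "map (r(a := x)) as \<in> R" using satisfiesD[OF that(1) c] by (simp add: map_fun_upd)
  qed
  show "a0 \<in> elems (inst_of Q)"
  proof (rule ccontr)
    assume "a0 \<notin> elems (inst_of Q)"
    from no_extension[OF upd[OF satisfies_one this, of g]] show False using distinct by auto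
  qed
  show "a1 \<in> elems (inst_of Q)"
  proof (rule ccontr)
    assume "a1 \<notin> elems (inst_of Q)"
    from no_extension[OF upd[OF p(1) this, of "\<one>\<^bsub>\<gamma> a1\<^esub>"]] show False using distinct p(3) by auto
  qed
  show "a2 \<in> elems (inst_of Q)"
  proof (rule ccontr)
    assume "a2 \<notin> elems (inst_of Q)"
    from no_extension[OF upd[OF q(1) this, of "\<one>\<^bsub>\<gamma> a2\<^esub>"]] show False using distinct q(3,4) by auto
  qed
qed

text \<open>The projection of the satisfying assignments to three coordinates, hence a subgroup of
  the product of the three groups.\<close>

definition P :: "'t \<Rightarrow> 't \<Rightarrow> 't \<Rightarrow> bool" where
  "P x y z \<longleftrightarrow> (\<exists>r. satisfies r Q \<and> r a0 = x \<and> r a1 = y \<and> r a2 = z)"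

lemma P_carrier: "P x y z \<Longrightarrow> x \<in> carrier (\<gamma> a0) \<and> y \<in> carrier (\<gamma> a1) \<and> z \<in> carrier (\<gamma> a2)"
  unfolding P_def using satisfies_carrier mem_elems by metis

lemma P_one: "P \<one>\<^bsub>\<gamma> a0\<^esub> \<one>\<^bsub>\<gamma> a1\<^esub> \<one>\<^bsub>\<gamma> a2\<^esub>"
  unfolding P_def using satisfies_one by blast

lemma P_mult:
  "P x y z \<Longrightarrow> P x' y' z' \<Longrightarrow> P (x \<otimes>\<^bsub>\<gamma> a0\<^esub> x') (y \<otimes>\<^bsub>\<gamma> a1\<^esub> y') (z \<otimes>\<^bsub>\<gamma> a2\<^esub> z')"
  unfolding P_def using satisfies_mult by fast

lemma P_inv: "P x y z \<Longrightarrow> P (inv\<^bsub>\<gamma> a0\<^esub> x) (inv\<^bsub>\<gamma> a1\<^esub> y) (inv\<^bsub>\<gamma> a2\<^esub> z)"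
  unfolding P_def using satisfies_inv by fast

abbreviation "G \<equiv> \<gamma> a0"

definition M :: "'t set" where
  "M = {m. (\<exists>y. P m y \<one>\<^bsub>\<gamma> a2\<^esub>) \<and> (\<exists>z. P m \<one>\<^bsub>\<gamma> a1\<^esub> z)}"

definition N :: "'t set" where
  "N = {m. P m \<one>\<^bsub>\<gamma> a1\<^esub> \<one>\<^bsub>\<gamma> a2\<^esub>}"

abbreviation "GM \<equiv> G\<lparr>carrier := M\<rparr>"

lemma one_simps [simp]:
  "\<one>\<^bsub>\<gamma> a\<^esub> \<otimes>\<^bsub>\<gamma> a\<^esub> \<one>\<^bsub>\<gamma> a\<^esub> = \<one>\<^bsub>\<gamma> a\<^esub>" "inv\<^bsub>\<gamma> a\<^esub> \<one>\<^bsub>\<gamma> a\<^esub> = \<one>\<^bsub>\<gamma> a\<^esub>"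
proof -
  interpret group "\<gamma> a" by simp
  show "\<one>\<^bsub>\<gamma> a\<^esub> \<otimes>\<^bsub>\<gamma> a\<^esub> \<one>\<^bsub>\<gamma> a\<^esub> = \<one>\<^bsub>\<gamma> a\<^esub>" "inv\<^bsub>\<gamma> a\<^esub> \<one>\<^bsub>\<gamma> a\<^esub> = \<one>\<^bsub>\<gamma> a\<^esub>" by auto
qed

lemma subgroup_M: "subgroup M G"
proof (rule group.subgroupI)
  show "M \<subseteq> carrier G" "M \<noteq> {}" using P_carrier P_one by (auto simp: M_def)
  show "inv\<^bsub>G\<^esub> m \<in> M" if "m \<in> M" for m
    using that P_inv by (fastforce simp: M_def)
  show "m \<otimes>\<^bsub>G\<^esub> m' \<in> M" if "m \<in> M" "m' \<in> M" for m m'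
    using that P_mult by (fastforce simp: M_def)
qed simp

lemma subgroup_N: "subgroup N G"
proof (rule group.subgroupI)
  show "N \<subseteq> carrier G" "N \<noteq> {}" using P_carrier P_one by (auto simp: N_def)
  show "inv\<^bsub>G\<^esub> m \<in> N" if "m \<in> N" for m
    using that P_inv by (fastforce simp: N_def)
  show "m \<otimes>\<^bsub>G\<^esub> m' \<in> N" if "m \<in> N" "m' \<in> N" for m m'
    using that P_mult by (fastforce simp: N_def)
qed simp

lemma N_subset_M: "N \<subseteq> M"
  by (auto simp: N_def M_def)

text \<open>The commutator of $(m,y,1)$ and $(m',1,z)$ is $([m,m'],1,1)$.\<close>

lemma commutator_in_N:
  assumes "m \<in> M" "m' \<in> M"
  shows "(m \<otimes>\<^bsub>G\<^esub> m') \<otimes>\<^bsub>G\<^esub> inv\<^bsub>G\<^esub> (m' \<otimes>\<^bsub>G\<^esub> m) \<in> N"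
proof -
  obtain y z where yz: "P m y \<one>\<^bsub>\<gamma> a2\<^esub>" "P m' \<one>\<^bsub>\<gamma> a1\<^esub> z" using assms by (auto simp: M_def)
  interpret G1: group "\<gamma> a1" by simp
  interpret G2: group "\<gamma> a2" by simp
  show ?thesis
    using P_mult[OF P_mult[OF yz] P_inv[OF P_mult[OF yz(2,1)]]] P_carrier[OF yz(1)] P_carrier[OF yz(2)]
    by (simp add: N_def)
qed

lemma normal_N: "N \<lhd> GM"
proof -
  interpret G: group G by simp
  interpret GM: group GM using subgroup_M G.subgroup_imp_group by blast
  have inv: "inv\<^bsub>GM\<^esub> m = inv\<^bsub>G\<^esub> m" if "m \<in> M" for m
    using G.m_inv_consistent[OF subgroup_M that] .
  have M: "M \<subseteq> carrier G" using subgroup.subset[OF subgroup_M] .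
  have "subgroup N GM" using G.subgroup_incl[OF subgroup_N subgroup_M N_subset_M] .
  moreover have "m \<otimes>\<^bsub>G\<^esub> h \<otimes>\<^bsub>G\<^esub> inv\<^bsub>G\<^esub> m \<in> N" if "m \<in> M" "h \<in> N" for m h
  proof -
    have c: "m \<in> carrier G" "h \<in> carrier G" using that M N_subset_M by auto
    have "(m \<otimes>\<^bsub>G\<^esub> h) \<otimes>\<^bsub>G\<^esub> inv\<^bsub>G\<^esub> (h \<otimes>\<^bsub>G\<^esub> m) \<otimes>\<^bsub>G\<^esub> h \<in> N"
      using commutator_in_N[of m h] that N_subset_M subgroup.m_closed[OF subgroup_N] by blast
    also have "(m \<otimes>\<^bsub>G\<^esub> h) \<otimes>\<^bsub>G\<^esub> inv\<^bsub>G\<^esub> (h \<otimes>\<^bsub>G\<^esub> m) \<otimes>\<^bsub>G\<^esub> h = m \<otimes>\<^bsub>G\<^esub> h \<otimes>\<^bsub>G\<^esub> inv\<^bsub>G\<^esub> m"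
      using c by (simp add: G.inv_mult_group G.m_assoc)
    finally show ?thesis .
  qed
  ultimately show ?thesis
    by (intro GM.normal_invI) (auto simp: inv)
qed

lemma coset_eqI:
  assumes "m \<in> M" "m' \<in> M" "m \<otimes>\<^bsub>G\<^esub> inv\<^bsub>G\<^esub> m' \<in> N"
  shows "N #>\<^bsub>GM\<^esub> m = N #>\<^bsub>GM\<^esub> m'"
proof -
  interpret G: group G by simp
  interpret GM: group GM using subgroup_M G.subgroup_imp_group by blast
  interpret N: normal N GM by (rule normal_N)
  have "m = (m \<otimes>\<^bsub>G\<^esub> inv\<^bsub>G\<^esub> m') \<otimes>\<^bsub>GM\<^esub> m'"
    using assms subgroup.mem_carrier[OF subgroup_M] by (simp add: G.m_assoc)
  then have "m \<in> N #>\<^bsub>GM\<^esub> m'" using assms(3) unfolding r_coset_def by blast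
  then show ?thesis using GM.repr_independence[OF _ _ N.subgroup_axioms] assms(2) by simp
qed

lemma comm_group_quotient: "comm_group (GM Mod N)"
proof -
  interpret G: group G by simp
  interpret GM: group GM using subgroup_M G.subgroup_imp_group by blast
  interpret N: normal N GM by (rule normal_N)
  have "N #>\<^bsub>GM\<^esub> (m \<otimes>\<^bsub>G\<^esub> m') = N #>\<^bsub>GM\<^esub> (m' \<otimes>\<^bsub>G\<^esub> m)" if m: "m \<in> M" "m' \<in> M" for m m'
    using m subgroup.m_closed[OF subgroup_M] by (intro coset_eqI commutator_in_N) auto
  then have "x \<otimes>\<^bsub>GM Mod N\<^esub> y = y \<otimes>\<^bsub>GM Mod N\<^esub> x" if "x \<in> carrier (GM Mod N)" "y \<in> carrier (GM Mod N)" for x y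
    using that N.rcos_sum by (auto simp: FactGroup_def RCOSETS_def)
  then show ?thesis
    using group.group_comm_groupI[OF N.factorgroup_is_group] by blast
qed

lemma g_in_M: "g \<in> M"
  unfolding M_def P_def using p(1,3) q(1,3,4) by blast

lemma g_notin_N: "g \<notin> N"
  unfolding N_def P_def using no_extension by blast

text \<open>The product of the first two triples is $(x x', y, z')$. Dividing the third triple by it
  leaves $(x'' (x x')^{-1}, 1, 1)$, so \<open>P\<close> expresses addition modulo
  \<open>N\<close>.\<close>

lemma P_sum:
  assumes "P x y \<one>\<^bsub>\<gamma> a2\<^esub>" "P x' \<one>\<^bsub>\<gamma> a1\<^esub> z'" "P x'' y z'" "x \<in> M" "x' \<in> M" "x'' \<in> M"
  shows "N #>\<^bsub>GM\<^esub> x'' = N #>\<^bsub>GM\<^esub> (x \<otimes>\<^bsub>G\<^esub> x')"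
proof -
  interpret G: group G by simp
  interpret G1: group "\<gamma> a1" by simp
  interpret G2: group "\<gamma> a2" by simp
  interpret GM: group GM using subgroup_M G.subgroup_imp_group by blast
  interpret N: normal N GM by (rule normal_N)
  have c: "x \<in> carrier G" "x' \<in> carrier G" "x'' \<in> carrier G" "x \<otimes>\<^bsub>G\<^esub> x' \<in> M"
    using assms subgroup.subset[OF subgroup_M] subgroup.m_closed[OF subgroup_M] by auto
  have n: "x'' \<otimes>\<^bsub>G\<^esub> inv\<^bsub>G\<^esub> (x \<otimes>\<^bsub>G\<^esub> x') \<in> N"
    using P_mult[OF assms(3) P_inv[OF P_mult[OF assms(1,2)]]]
      P_carrier[OF assms(1)] P_carrier[OF assms(2)] by (simp add: N_def)
  then show ?thesis using coset_eqI assms(6) c(4) by blast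
qed

text \<open>The first components of \<open>U\<close> are the entries of a matrix modulo \<open>N\<close>, and those of \<open>Y\<close> and
  \<open>Z\<close> are the partial sums along its columns and rows; the other components are the witnesses
  for membership in \<open>M\<close>.\<close>

lemma no_charged_grid:
  fixes U Y Z :: "nat \<Rightarrow> nat \<Rightarrow> 't \<times> 't \<times> 't"
  assumes edge: "\<And>W i j x y z. W \<in> {U, Y, Z} \<Longrightarrow> i \<le> n \<Longrightarrow> j \<le> n \<Longrightarrow> W i j = (x, y, z) \<Longrightarrow>
      P x y \<one>\<^bsub>\<gamma> a2\<^esub> \<and> P x \<one>\<^bsub>\<gamma> a1\<^esub> z"
    and Y: "\<And>i j. i < n \<Longrightarrow> j < n \<Longrightarrow> P (fst (Y (Suc i) j)) (fst (snd (Y i j))) (snd (snd (U i j)))"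
    and Z: "\<And>i j. i < n \<Longrightarrow> j < n \<Longrightarrow> P (fst (Z i (Suc j))) (fst (snd (Z i j))) (snd (snd (U i j)))"
    and bd: "\<And>i. i < n \<Longrightarrow> fst (Z i 0) = \<one>\<^bsub>G\<^esub>" "\<And>i. i < n \<Longrightarrow> fst (Z i n) = \<one>\<^bsub>G\<^esub>"
      "\<And>j. j < n \<Longrightarrow> fst (Y n j) = \<one>\<^bsub>G\<^esub>"
      "\<And>j. j < n \<Longrightarrow> fst (Y 0 j) = (if j = j0 then g else \<one>\<^bsub>G\<^esub>)"
  shows "\<not> j0 < n"
proof
  assume j0: "j0 < n"
  interpret G: group G by simp
  interpret GM: group GM using subgroup_M G.subgroup_imp_group by blast
  interpret N: normal N GM by (rule normal_N)
  interpret A: comm_group "GM Mod N" by (rule comm_group_quotient)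
  \<comment> \<open>\<open>grid_product\<close> asks for group elements at all indices; the identity
    fills the positions outside the grid.\<close>
  define f where "f W i j = (if i \<le> n \<and> j \<le> n then N #>\<^bsub>GM\<^esub> fst (W i j) else \<one>\<^bsub>GM Mod N\<^esub>)"
    for W :: "nat \<Rightarrow> nat \<Rightarrow> 't \<times> 't \<times> 't" and i j
  have one: "N #>\<^bsub>GM\<^esub> \<one>\<^bsub>G\<^esub> = \<one>\<^bsub>GM Mod N\<^esub>"
    using GM.coset_mult_one[of N] N.subset by (simp add: FactGroup_def)
  have M: "fst (W i j) \<in> M" if "W \<in> {U, Y, Z}" "i \<le> n" "j \<le> n" for W i j
    using edge[OF that] by (cases "W i j") (auto simp: M_def)
  have coset: "N #>\<^bsub>GM\<^esub> m \<in> carrier (GM Mod N)" if "m \<in> M" for m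
    using that by (auto simp: carrier_FactGroup)
  have carr: "f W i j \<in> carrier (GM Mod N)" if "W \<in> {U, Y, Z}" for W i j
    using M[OF that, of i j] coset[of "fst (W i j)"] A.one_closed unfolding f_def by presburger
  have sum: "N #>\<^bsub>GM\<^esub> fst (W'' k l) = (N #>\<^bsub>GM\<^esub> fst (W i j)) \<otimes>\<^bsub>GM Mod N\<^esub> (N #>\<^bsub>GM\<^esub> fst (U i j))"
    if "W \<in> {U, Y, Z}" "W'' \<in> {U, Y, Z}" "i \<le> n" "j \<le> n" "k \<le> n" "l \<le> n"
      "P (fst (W'' k l)) (fst (snd (W i j))) (snd (snd (U i j)))" for W W'' i j k l
  proof -
    have "N #>\<^bsub>GM\<^esub> fst (W'' k l) = N #>\<^bsub>GM\<^esub> (fst (W i j) \<otimes>\<^bsub>G\<^esub> fst (U i j))"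
      using edge[OF that(1,3,4)] edge[of U i j] that M
      by (intro P_sum[OF _ _ that(7)]) (auto simp: prod_eq_iff)
    then show ?thesis using N.rcos_sum[of "fst (W i j)" "fst (U i j)"] M[OF that(1,3,4)] M[of U i j] that
      by (simp add: FactGroup_def)
  qed
  have "(\<Otimes>\<^bsub>GM Mod N\<^esub>j\<in>{..<n}. f Y 0 j) = \<one>\<^bsub>GM Mod N\<^esub>"
  proof (rule A.grid_product[where U = "f U" and Z = "f Z"])
    show "f Y (Suc i) j = f Y i j \<otimes>\<^bsub>GM Mod N\<^esub> f U i j" if "i < n" "j < n" for i j
      using sum[of Y Y i j "Suc i" j] Y that by (simp add: f_def)
    show "f Z i (Suc j) = f Z i j \<otimes>\<^bsub>GM Mod N\<^esub> f U i j" if "i < n" "j < n" for i j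
      using sum[of Z Z i j i "Suc j"] Z that by (simp add: f_def)
  qed (use carr bd one in \<open>auto simp: f_def\<close>)
  moreover have "(\<Otimes>\<^bsub>GM Mod N\<^esub>j\<in>{..<n}. f Y 0 j) =
      (\<Otimes>\<^bsub>GM Mod N\<^esub>j\<in>{..<n}. if j0 = j then (N #>\<^bsub>GM\<^esub> g) else \<one>\<^bsub>GM Mod N\<^esub>)"
    using coset[OF g_in_M] bd(4) one
    by (intro A.finprod_cong') (auto simp: f_def simp del: one_FactGroup intro!: A.one_closed)
  moreover have "\<dots> = N #>\<^bsub>GM\<^esub> g"
    using A.finprod_singleton[of j0 "{..<n}" "\<lambda>_. N #>\<^bsub>GM\<^esub> g"] j0 g_in_M by (auto simp: carrier_FactGroup)
  ultimately have "N #>\<^bsub>GM\<^esub> g = N" by (simp add: FactGroup_def)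
  then have "g \<in> N" using GM.rcos_self[of g N] g_in_M N.subgroup_axioms by auto
  then show False using g_notin_N by simp
qed

end

section \<open>Grids of gadgets\<close>

text \<open>\<open>Col i j\<close> and \<open>Row i j\<close> stand for the sums of the first \<open>i\<close> entries of column \<open>j\<close> (added
  to the charge of the column) and of the first \<open>j\<close> entries of row \<open>i\<close>. The value of a cell is stored in the nodes \<open>V0\<close>, \<open>V1\<close>, \<open>V2\<close> as a
  triple $(m,y,z)$; the copies \<open>Edge1\<close> and \<open>Edge2\<close> of the gadget ensure that it satisfies
  $P(m,y,1)$ and $P(m,1,z)$. The sockets of a copy are the nodes that take the places of \<open>a0\<close>,
  \<open>a1\<close> and \<open>a2\<close>.\<close>

datatype cell = Entry nat nat | Col nat nat | Row nat nat

datatype copy = Edge1 cell | Edge2 cell | ColEq nat nat | RowEq nat nat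

datatype 'a node = V0 cell | V1 cell | V2 cell | One1 | One2 | Inner copy 'a

instance cell :: countable by countable_datatype

instance copy :: countable by countable_datatype

primrec socket0 :: "copy \<Rightarrow> 'a node" where
  "socket0 (Edge1 w) = V0 w"
| "socket0 (Edge2 w) = V0 w"
| "socket0 (ColEq i j) = V0 (Col (Suc i) j)"
| "socket0 (RowEq i j) = V0 (Row i (Suc j))"

primrec socket1 :: "copy \<Rightarrow> 'a node" where
  "socket1 (Edge1 w) = V1 w"
| "socket1 (Edge2 w) = One1"
| "socket1 (ColEq i j) = V1 (Col i j)"
| "socket1 (RowEq i j) = V1 (Row i j)"

primrec socket2 :: "copy \<Rightarrow> 'a node" where
  "socket2 (Edge1 w) = One2"
| "socket2 (Edge2 w) = V2 w"
| "socket2 (ColEq i j) = V2 (Entry i j)"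
| "socket2 (RowEq i j) = V2 (Entry i j)"

text \<open>Indices run up to \<open>n\<close> inclusive because a line of \<open>n\<close> entries
  has \<open>n + 1\<close> partial sums.\<close>

definition cells :: "nat \<Rightarrow> cell set" where
  "cells n = (\<Union>i \<in> {..n}. \<Union>j \<in> {..n}. {Entry i j, Col i j, Row i j})"

definition copies :: "nat \<Rightarrow> copy set" where
  "copies n = Edge1 ` cells n \<union> Edge2 ` cells n \<union> (\<Union>i \<in> {..<n}. \<Union>j \<in> {..<n}. {ColEq i j, RowEq i j})"

lemma finite_copies: "finite (copies n)"
  by (simp add: copies_def cells_def)

text \<open>A line is a column (\<open>Inl\<close>) or a row (\<open>Inr\<close>). The value for \<open>One1\<close> and
  \<open>One2\<close> is arbitrary, since charges never move through them.\<close>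

primrec cell_line :: "cell \<Rightarrow> nat + nat" where
  "cell_line (Entry i j) = Inr i"
| "cell_line (Col i j) = Inl j"
| "cell_line (Row i j) = Inr i"

primrec copy_line :: "copy \<Rightarrow> nat + nat" where
  "copy_line (Edge1 w) = cell_line w"
| "copy_line (Edge2 w) = cell_line w"
| "copy_line (ColEq i j) = Inl j"
| "copy_line (RowEq i j) = Inr i"

primrec line :: "'a node \<Rightarrow> nat + nat" where
  "line (V0 w) = cell_line w"
| "line (V1 w) = cell_line w"
| "line (V2 w) = cell_line w"
| "line One1 = Inl 0"
| "line One2 = Inl 0"
| "line (Inner k a) = copy_line k"

text \<open>The integral flow that moves a unit of charge from column \<open>j1\<close> to column \<open>j2\<close> through row
  \<open>i0\<close>.\<close>

primrec flow :: "nat \<Rightarrow> nat \<Rightarrow> nat \<Rightarrow> cell \<Rightarrow> int" where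
  "flow i0 j1 j2 (Entry i j) = (if i = i0 then of_bool (j = j1) - of_bool (j = j2) else 0)"
| "flow i0 j1 j2 (Col i j) = (if i \<le> i0 then of_bool (j = j2) - of_bool (j = j1) else 0)"
| "flow i0 j1 j2 (Row i j) = (if i = i0 then of_bool (j1 < j) - of_bool (j2 < j) else 0)"

text \<open>A pair $(k,l)$ stands for the assignment $p^k q^l$ of the copy. Its values at
  \<open>a0\<close>, \<open>a1\<close>, \<open>a2\<close> are $g^{k+l}$, $p(a_1)^k$ and
  $q(a_2)^l$.\<close>

primrec flow_copy :: "nat \<Rightarrow> nat \<Rightarrow> nat \<Rightarrow> copy \<Rightarrow> int \<times> int" where
  "flow_copy i0 j1 j2 (Edge1 w) = (flow i0 j1 j2 w, 0)"
| "flow_copy i0 j1 j2 (Edge2 w) = (0, flow i0 j1 j2 w)"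
| "flow_copy i0 j1 j2 (ColEq i j) = (flow i0 j1 j2 (Col i j), flow i0 j1 j2 (Entry i j))"
| "flow_copy i0 j1 j2 (RowEq i j) = (flow i0 j1 j2 (Row i j), flow i0 j1 j2 (Entry i j))"

lemma flow_line: "cell_line w \<notin> {Inl j1, Inl j2, Inr i0} \<Longrightarrow> flow i0 j1 j2 w = 0"
  by (cases w) auto

lemma flow_copy_line: "copy_line k \<notin> {Inl j1, Inl j2, Inr i0} \<Longrightarrow> flow_copy i0 j1 j2 k = (0, 0)"
  by (cases k) (auto simp: flow_line)

text \<open>The singleton of \<open>x\<close> is the translate by \<open>x\<close> of the singleton
  of the identity.\<close>

lemma (in coset_tmpl) relation_singleton:
  assumes "G \<in> \<G>" "x \<in> carrier G"
  shows "(1, {[x]}) \<in> trels T"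
proof -
  interpret group G using group_carrier assms by blast
  have "(1, {[\<one>\<^bsub>G\<^esub>]} #>\<^bsub>DirProd_list [G]\<^esub> [x]) \<in> trels T"
    using assms map_mem_DirProd_list[of "\<lambda>_. \<one>\<^bsub>G\<^esub>" "[()]" "\<lambda>_. G"] map_mem_DirProd_list[of "\<lambda>_. x" "[()]" "\<lambda>_. G"]
    by (intro relation_translate relation_one) auto
  moreover have "[\<one>\<^bsub>G\<^esub>] \<otimes>\<^bsub>DirProd_list [G]\<^esub> [x] = [x]"
    using assms mult_DirProd_list_map[of "[()]" "\<lambda>_. \<one>\<^bsub>G\<^esub>" "\<lambda>_. G" "\<lambda>_. x"] by simp
  ultimately show ?thesis by (simp add: r_coset_def)
qed

locale grid = gadget T \<G> \<gamma> Q a0 a1 a2 p q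
  for T :: "'t template" and \<G> and \<gamma> :: "'a \<Rightarrow> 't monoid" and Q a0 a1 a2 p q +
  fixes \<iota> :: "'a node \<Rightarrow> 'e" and n :: nat
  assumes inj_\<iota>: "inj \<iota>"
begin

section \<open>Nodes, groups and constraints of the grid\<close>

abbreviation "\<kappa> \<equiv> inv_into UNIV \<iota>"

lemma \<kappa>_\<iota> [simp]: "\<kappa> (\<iota> b) = b"
  using inj_\<iota> by simp

text \<open>Copies are glued along their sockets only; all other variables are private to the
  copy.\<close>

definition place :: "copy \<Rightarrow> 'a \<Rightarrow> 'a node" where
  "place k a = (if a = a0 then socket0 k else if a = a1 then socket1 k
     else if a = a2 then socket2 k else Inner k a)"

lemma place_simps [simp]:
  "place k a0 = socket0 k" "place k a1 = socket1 k" "place k a2 = socket2 k"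
  using distinct by (auto simp: place_def)

primrec node_group :: "'a node \<Rightarrow> 't monoid" where
  "node_group (V0 w) = \<gamma> a0"
| "node_group (V1 w) = \<gamma> a1"
| "node_group (V2 w) = \<gamma> a2"
| "node_group One1 = \<gamma> a1"
| "node_group One2 = \<gamma> a2"
| "node_group (Inner k a) = \<gamma> a"

lemma node_group_place [simp]: "node_group (place k a) = \<gamma> a"
  by (cases k) (auto simp: place_def)

lemma node_group_mem: "node_group b \<in> \<G>"
  using \<gamma> by (cases b) auto

text \<open>Outside the range of \<open>\<iota>\<close> this is the group of an arbitrary node, so
  all values are carrier groups, as \<open>typed\<close> demands.\<close>

definition \<Gamma> :: "'e \<Rightarrow> 't monoid" where
  "\<Gamma> x = node_group (\<kappa> x)"

lemma \<Gamma>_\<iota> [simp]: "\<Gamma> (\<iota> b) = node_group b"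
  by (simp add: \<Gamma>_def)

definition copy_constrs :: "('t relation \<times> 'e list) set" where
  "copy_constrs = (\<Union>k \<in> copies n. (\<lambda>(R, as). (R, map (\<lambda>a. \<iota> (place k a)) as)) ` Q)"

abbreviation pin :: "'a node \<Rightarrow> 't \<Rightarrow> ('t relation \<times> 'e list)" where
  "pin b x \<equiv> ((1, {[x]}), [\<iota> b])"

text \<open>The two constants, the empty sum at the start of each row, and the totals of rows and
  columns.\<close>

definition grounded :: "'a node set" where
  "grounded = {One1, One2} \<union> (\<lambda>i. V0 (Row i 0)) ` {..<n} \<union> (\<lambda>i. V0 (Row i n)) ` {..<n} \<union>
     (\<lambda>j. V0 (Col n j)) ` {..<n}"

text \<open>Column \<open>j\<close> starts from the charge \<open>c j\<close> and must end in the
  identity, so modulo \<open>N\<close> its entries have to cancel the charge.\<close>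

definition grid_constrs :: "(nat \<Rightarrow> 't) \<Rightarrow> ('t relation \<times> 'e list) set" where
  "grid_constrs c = copy_constrs \<union> (\<lambda>b. pin b \<one>\<^bsub>node_group b\<^esub>) ` grounded \<union>
     (\<lambda>j. pin (V0 (Col 0 j)) (c j)) ` {..<n}"

definition charge :: "nat \<Rightarrow> nat \<Rightarrow> 't" where
  "charge j0 j = (if j = j0 then g else \<one>\<^bsub>G\<^esub>)"

lemma one_mem [simp]: "\<one>\<^bsub>\<gamma> a\<^esub> \<in> carrier (\<gamma> a)"
  using group_\<gamma> by (metis group.is_monoid monoid.one_closed)

lemma charge_mem: "charge j0 j \<in> carrier G"
  using p(2) by (simp add: charge_def)

lemma typed_grid:
  assumes "\<And>j. c j \<in> carrier G"
  shows "typed T \<G> \<Gamma> (grid_constrs c)"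
proof -
  have pin: "(1, {[x]}) \<in> trels T \<and> length [\<iota> b] = 1 \<and> {[x]} \<subseteq> carrier (DirProd_list (map \<Gamma> [\<iota> b]))"
    if "x \<in> carrier (node_group b)" for x b
    using that relation_singleton[OF node_group_mem that]
      map_mem_DirProd_list[of "\<lambda>_. x" "[()]" "\<lambda>_. node_group b"] by simp
  have copy: "(m, R) \<in> trels T \<and> length (map (\<lambda>a. \<iota> (place k a)) as) = m \<and>
      R \<subseteq> carrier (DirProd_list (map \<Gamma> (map (\<lambda>a. \<iota> (place k a)) as)))" if "((m, R), as) \<in> Q" for m R as k
    using rel[OF that] subgroup.subset by (auto simp: comp_def)
  have one: "\<one>\<^bsub>node_group b\<^esub> \<in> carrier (node_group b)" for b
    using group_carrier[OF node_group_mem] by (metis group.is_monoid monoid.one_closed)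
  have "finite (grid_constrs c)"
    using finite_Q by (simp add: grid_constrs_def copy_constrs_def finite_copies grounded_def)
  moreover have "range \<Gamma> \<subseteq> \<G>" using node_group_mem by (auto simp: \<Gamma>_def)
  moreover have "(m, R) \<in> trels T \<and> length as = m \<and> R \<subseteq> carrier (DirProd_list (map \<Gamma> as))"
    if "((m, R), as) \<in> grid_constrs c" for m R as
    using that unfolding grid_constrs_def
  proof (elim UnE)
    assume "((m, R), as) \<in> copy_constrs"
    then obtain k bs where "((m, R), bs) \<in> Q" "as = map (\<lambda>a. \<iota> (place k a)) bs"
      by (auto simp: copy_constrs_def)
    then show ?thesis using copy[of m R bs k] by (simp only: simp_thms)
  next
    assume "((m, R), as) \<in> (\<lambda>b. pin b \<one>\<^bsub>node_group b\<^esub>) ` grounded"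
    then obtain b where "m = 1" "R = {[\<one>\<^bsub>node_group b\<^esub>]}" "as = [\<iota> b]" by auto
    then show ?thesis using pin[OF one[of b]] by simp
  next
    assume "((m, R), as) \<in> (\<lambda>j. pin (V0 (Col 0 j)) (c j)) ` {..<n}"
    then obtain j where "m = 1" "R = {[c j]}" "as = [\<iota> (V0 (Col 0 j))]" by auto
    then show ?thesis using pin[of "c j" "V0 (Col 0 j)"] assms by simp
  qed
  ultimately show ?thesis by (rule typedI)
qed

lemma satisfies_grid:
  "satisfies f (grid_constrs c) \<longleftrightarrow> (\<forall>k \<in> copies n. satisfies (\<lambda>a. f (\<iota> (place k a))) Q) \<and>
     (\<forall>b \<in> grounded. f (\<iota> b) = \<one>\<^bsub>node_group b\<^esub>) \<and> (\<forall>j < n. f (\<iota> (V0 (Col 0 j))) = c j)"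
  unfolding grid_constrs_def copy_constrs_def satisfies_Un satisfies_UN satisfies_map satisfies_singletons
  by auto

lemma satisfiable_uncharged: "\<exists>f. satisfies f (grid_constrs (\<lambda>_. \<one>\<^bsub>G\<^esub>))"
proof
  show "satisfies (\<lambda>x. \<one>\<^bsub>\<Gamma> x\<^esub>) (grid_constrs (\<lambda>_. \<one>\<^bsub>G\<^esub>))"
    using satisfies_one by (simp add: satisfies_grid)
qed

lemma unsatisfiable_charged:
  assumes "j0 < n"
  shows "\<not> satisfies f (grid_constrs (charge j0))"
proof
  assume f: "satisfies f (grid_constrs (charge j0))"
  define F where "F b = f (\<iota> b)" for b
  have P: "P (F (socket0 k)) (F (socket1 k)) (F (socket2 k))" if "k \<in> copies n" for k
    unfolding P_def using f that place_simps unfolding satisfies_grid F_def by metis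
  have ground: "F b = \<one>\<^bsub>node_group b\<^esub>" if "b \<in> grounded" for b
    using f that by (simp add: satisfies_grid F_def)
  have ones: "F One1 = \<one>\<^bsub>\<gamma> a1\<^esub>" "F One2 = \<one>\<^bsub>\<gamma> a2\<^esub>"
    using ground[of One1] ground[of One2] by (auto simp: grounded_def)
  define W where "W C i j = (F (V0 (C i j)), F (V1 (C i j)), F (V2 (C i j)))" for C :: "nat \<Rightarrow> nat \<Rightarrow> cell" and i j
  have edge: "P (F (V0 w)) (F (V1 w)) \<one>\<^bsub>\<gamma> a2\<^esub> \<and> P (F (V0 w)) \<one>\<^bsub>\<gamma> a1\<^esub> (F (V2 w))" if "w \<in> cells n" for w
    using P[of "Edge1 w"] P[of "Edge2 w"] that ones by (simp add: copies_def)
  have "\<not> j0 < n"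
  proof (rule no_charged_grid[of "W Entry" "W Col" "W Row"])
    show "P x y \<one>\<^bsub>\<gamma> a2\<^esub> \<and> P x \<one>\<^bsub>\<gamma> a1\<^esub> z"
      if "D \<in> {W Entry, W Col, W Row}" "i \<le> n" "j \<le> n" "D i j = (x, y, z)" for D i j x y z
      using that edge[of "Entry i j"] edge[of "Col i j"] edge[of "Row i j"] by (auto simp: W_def cells_def)
    show "P (fst (W Col (Suc i) j)) (fst (snd (W Col i j))) (snd (snd (W Entry i j)))" if "i < n" "j < n" for i j
      using P[of "ColEq i j"] that by (simp add: copies_def W_def)
    show "P (fst (W Row i (Suc j))) (fst (snd (W Row i j))) (snd (snd (W Entry i j)))" if "i < n" "j < n" for i j
      using P[of "RowEq i j"] that by (simp add: copies_def W_def)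
    show "fst (W Col 0 j) = (if j = j0 then g else \<one>\<^bsub>G\<^esub>)" if "j < n" for j
      using f that by (simp add: satisfies_grid W_def F_def charge_def)
  qed (use ground in \<open>auto simp: W_def grounded_def\<close>)
  then show False using assms by simp
qed

section \<open>Dependence of the grid on the charges, and moving a charge\<close>

lemma elems_grid: "elems (inst_of (grid_constrs c)) = elems (inst_of (grid_constrs c'))"
  by (simp add: elems_inst_of grid_constrs_def)

text \<open>The charges enter only through the unary constraints at the starts of the
  columns.\<close>

lemma restrict_grid:
  assumes "\<And>j. j < n \<Longrightarrow> \<iota> (V0 (Col 0 j)) \<in> S \<Longrightarrow> c j = c' j"
  shows "restrict_inst (inst_of (grid_constrs c)) S = restrict_inst (inst_of (grid_constrs c')) S"
proof -
  have "(\<lambda>j. pin (V0 (Col 0 j)) (c j)) ` {..<n} \<inter> {x. set (snd x) \<subseteq> S} =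
      (\<lambda>j. pin (V0 (Col 0 j)) (c j)) ` {j \<in> {..<n}. \<iota> (V0 (Col 0 j)) \<in> S}" for c
    by auto
  moreover have "(\<lambda>j. pin (V0 (Col 0 j)) (c j)) ` {j \<in> {..<n}. \<iota> (V0 (Col 0 j)) \<in> S} =
      (\<lambda>j. pin (V0 (Col 0 j)) (c' j)) ` {j \<in> {..<n}. \<iota> (V0 (Col 0 j)) \<in> S}"
    using assms by (intro image_cong) auto
  ultimately have "grid_constrs c \<inter> {x. set (snd x) \<subseteq> S} = grid_constrs c' \<inter> {x. set (snd x) \<subseteq> S}"
    unfolding grid_constrs_def Int_Un_distrib2 by (simp only:)
  moreover have "{(R, as) \<in> B. set as \<subseteq> S} = B \<inter> {x. set (snd x) \<subseteq> S}"
    for B :: "('t relation \<times> 'e list) set" by auto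
  ultimately show ?thesis using elems_grid[of c c'] by (simp add: restrict_inst_def)
qed

text \<open>The flow turned into group elements: flow $c$ through a cell becomes the triple $(g^c,
  p(a_1)^c, q(a_2)^c)$, and the inner nodes of a copy take the values of $p^k q^l$ for its pair
  $(k,l)$.\<close>

primrec mover :: "nat \<Rightarrow> nat \<Rightarrow> nat \<Rightarrow> 'a node \<Rightarrow> 't" where
  "mover i0 j1 j2 (V0 w) = p a0 [^]\<^bsub>\<gamma> a0\<^esub> flow i0 j1 j2 w"
| "mover i0 j1 j2 (V1 w) = p a1 [^]\<^bsub>\<gamma> a1\<^esub> flow i0 j1 j2 w"
| "mover i0 j1 j2 (V2 w) = q a2 [^]\<^bsub>\<gamma> a2\<^esub> flow i0 j1 j2 w"
| "mover i0 j1 j2 One1 = \<one>\<^bsub>\<gamma> a1\<^esub>"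
| "mover i0 j1 j2 One2 = \<one>\<^bsub>\<gamma> a2\<^esub>"
| "mover i0 j1 j2 (Inner k a) = p a [^]\<^bsub>\<gamma> a\<^esub> fst (flow_copy i0 j1 j2 k) \<otimes>\<^bsub>\<gamma> a\<^esub> q a [^]\<^bsub>\<gamma> a\<^esub> snd (flow_copy i0 j1 j2 k)"

lemma mover_mem: "mover i0 j1 j2 b \<in> carrier (node_group b)"
proof -
  have "p a [^]\<^bsub>\<gamma> a\<^esub> (k::int) \<in> carrier (\<gamma> a)" "q a [^]\<^bsub>\<gamma> a\<^esub> (k::int) \<in> carrier (\<gamma> a)" for a k
    by (rule group.int_pow_closed[OF group_\<gamma> p(2)], rule group.int_pow_closed[OF group_\<gamma> q(2)])
  moreover have "x \<otimes>\<^bsub>\<gamma> a\<^esub> y \<in> carrier (\<gamma> a)" if "x \<in> carrier (\<gamma> a)" "y \<in> carrier (\<gamma> a)" for a x y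
    by (rule monoid.m_closed[OF group.is_monoid[OF group_\<gamma>] that])
  ultimately show ?thesis by (cases b) simp_all
qed

lemma mover_line:
  assumes "line b \<notin> {Inl j1, Inl j2, Inr i0}"
  shows "mover i0 j1 j2 b = \<one>\<^bsub>node_group b\<^esub>"
  using assms flow_line[of _ j1 j2 i0] flow_copy_line[of _ j1 j2 i0] by (cases b) (simp_all add: int_pow_0)

text \<open>On each copy, sockets included, the mover is a product of powers of \<open>p\<close> and
  \<open>q\<close>, and hence satisfies \<open>Q\<close>.\<close>

lemma mover_place:
  "mover i0 j1 j2 (place k a) =
     p a [^]\<^bsub>\<gamma> a\<^esub> fst (flow_copy i0 j1 j2 k) \<otimes>\<^bsub>\<gamma> a\<^esub> q a [^]\<^bsub>\<gamma> a\<^esub> snd (flow_copy i0 j1 j2 k)"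
proof -
  interpret G0: group "\<gamma> a0" by simp
  interpret G1: group "\<gamma> a1" by simp
  interpret G2: group "\<gamma> a2" by simp
  have pq: "p a \<in> carrier (\<gamma> a)" "q a \<in> carrier (\<gamma> a)" using p(2) q(2) by auto
  consider "a = a0" | "a = a1" | "a = a2" | "a \<notin> {a0, a1, a2}" by auto
  then show ?thesis
  proof cases
    case 1
    obtain w where w: "socket0 k = (V0 w :: 'a node)" by (cases k) auto
    \<comment> \<open>Conservation of the flow: the flow through socket 0 is the sum of the two
      components of the pair.\<close>
    then have "flow i0 j1 j2 w = fst (flow_copy i0 j1 j2 k) + snd (flow_copy i0 j1 j2 k)"
      by (cases k) auto
    with w show ?thesis using 1 pq q(4) by (simp add: G0.int_pow_mult)
  next
    case 2
    then show ?thesis using pq q(3) by (cases k) simp_all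
  next
    case 3
    then show ?thesis using pq p(3) by (cases k) simp_all
  next
    case 4
    then show ?thesis by (simp add: place_def)
  qed
qed

lemma shift_pin:
  assumes "x \<in> carrier (node_group b)" "f (\<iota> b) \<in> carrier (node_group b)"
  shows "shift \<Gamma> f (pin b x) = pin b (x \<otimes>\<^bsub>node_group b\<^esub> f (\<iota> b))"
  using mult_DirProd_list_map[of "[()]" "\<lambda>_. x" "\<lambda>_. node_group b" "\<lambda>_. f (\<iota> b)"] assms
  by (simp add: shift_def r_coset_def)

text \<open>A subgroup is unchanged by translation by one of its own elements.\<close>

lemma shift_copy:
  assumes "satisfies (\<lambda>a. f (\<iota> (place k a))) Q" "((m, R), as) \<in> Q"
  shows "shift \<Gamma> f ((m, R), map (\<lambda>a. \<iota> (place k a)) as) = ((m, R), map (\<lambda>a. \<iota> (place k a)) as)"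
proof -
  have "subgroup R (DirProd_list (map \<gamma> as))" using rel[OF assms(2)] by blast
  moreover have "group (DirProd_list (map \<gamma> as))" by (rule group_DirProd_list_map) simp
  ultimately have "R #>\<^bsub>DirProd_list (map \<gamma> as)\<^esub> map (\<lambda>a. f (\<iota> (place k a))) as = R"
    using satisfiesD[OF assms] by (metis group.coset_join2 subgroup.mem_carrier)
  then show ?thesis by (simp add: shift_def comp_def)
qed

text \<open>Copies are invariant and grounded nodes carry no flow. At the column starts, exponent -1
  cancels the charge of \<open>j1\<close> and exponent 1 creates that of \<open>j2\<close>.\<close>

lemma shift_grid:
  assumes "i0 < n" "j1 < n" "j2 < n" "j1 \<noteq> j2"
  defines "f \<equiv> \<lambda>x. mover i0 j1 j2 (\<kappa> x)"
  shows "shift \<Gamma> f ` grid_constrs (charge j1) = grid_constrs (charge j2)"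
proof -
  interpret group G by simp
  have f: "f (\<iota> b) = mover i0 j1 j2 b" for b by (simp add: f_def)
  have "satisfies (\<lambda>a. f (\<iota> (place k a))) Q" for k
    unfolding f mover_place using satisfies_mult satisfies_int_pow p(1) q(1) by blast
  then have "shift \<Gamma> f ` copy_constrs = copy_constrs"
    unfolding copy_constrs_def image_UN image_image
    by (intro SUP_cong refl image_cong) (auto simp: shift_copy)
  moreover have "shift \<Gamma> f ` (\<lambda>b. pin b \<one>\<^bsub>node_group b\<^esub>) ` grounded = (\<lambda>b. pin b \<one>\<^bsub>node_group b\<^esub>) ` grounded"
    unfolding image_image
  proof (rule image_cong[OF refl])
    fix b assume "b \<in> grounded"
    \<comment> \<open>The flow has left the columns below row \<open>i0\<close>, and both its ends
      lie before position \<open>n\<close> of the row, so the totals carry none.\<close>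
    then have "mover i0 j1 j2 b = \<one>\<^bsub>node_group b\<^esub>" using assms(1-3) by (auto simp: grounded_def)
    moreover have "group (node_group b)" using group_carrier[OF node_group_mem] .
    ultimately show "shift \<Gamma> f (pin b \<one>\<^bsub>node_group b\<^esub>) = pin b \<one>\<^bsub>node_group b\<^esub>"
      by (subst shift_pin) (simp_all add: f group.is_monoid monoid.one_closed monoid.l_one)
  qed
  moreover have "shift \<Gamma> f ` (\<lambda>j. pin (V0 (Col 0 j)) (charge j1 j)) ` {..<n} =
      (\<lambda>j. pin (V0 (Col 0 j)) (charge j2 j)) ` {..<n}"
    unfolding image_image
  proof (rule image_cong[OF refl])
    fix j
    have "charge j1 j \<otimes>\<^bsub>G\<^esub> mover i0 j1 j2 (V0 (Col 0 j)) = charge j2 j"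
      using assms(4) p(2)[of a0] by (auto simp: charge_def int_pow_neg int_pow_1)
    then show "shift \<Gamma> f (pin (V0 (Col 0 j)) (charge j1 j)) = pin (V0 (Col 0 j)) (charge j2 j)"
      using charge_mem mover_mem[of i0 j1 j2 "V0 (Col 0 j)"] by (subst shift_pin) (simp_all only: f node_group.simps)
  qed
  ultimately show ?thesis unfolding grid_constrs_def image_Un by simp
qed

section \<open>Free columns and the contradiction\<close>

definition free :: "'e set \<Rightarrow> nat set" where
  "free S = {j \<in> {..<n}. Inl j \<notin> (\<lambda>x. line (\<kappa> x)) ` S}"

text \<open>Each element is assigned one line, so fewer than \<open>n\<close> elements miss one of
  the \<open>n\<close> columns (\<open>c = Inl\<close>) or rows (\<open>c = Inr\<close>).\<close>

lemma free_line:
  assumes "inj c" "finite S" "card S < n"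
  shows "\<exists>j < n. c j \<notin> (\<lambda>x. line (\<kappa> x)) ` S"
proof (rule ccontr)
  assume "\<not> ?thesis"
  then have "c ` {..<n} \<subseteq> (\<lambda>x. line (\<kappa> x)) ` S" by auto
  then have "card (c ` {..<n}) \<le> card S"
    using assms(2) by (meson card_image_le card_mono finite_imageI order_trans)
  then show False using assms card_image[of c "{..<n}"] by (simp add: inj_on_subset)
qed

theorem algorithm_fooled:
  fixes A :: "('t, 'e, 'o) algorithm"
  assumes A: "coset_algorithm T \<G> A" "equivariant T \<G> A"
    and d: "\<And>I i. coset_inst T \<G> I \<Longrightarrow> i \<in> {1..stages A I} \<Longrightarrow>
      L0 T \<G> A d I i \<or> (L1 T \<G> A d I i \<and> L2 \<G> A d I i)"
    and n: "n > d + d * d" and solves: "solves_CSP T \<G> A"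
  shows False
proof -
  let ?I = "inst_of (grid_constrs (\<lambda>_. \<one>\<^bsub>G\<^esub>))" and ?I' = "\<lambda>j. inst_of (grid_constrs (charge j))"
  have ty: "typed T \<G> \<Gamma> (grid_constrs (\<lambda>_. \<one>\<^bsub>G\<^esub>))" "typed T \<G> \<Gamma> (grid_constrs (charge j))" for j
    using typed_grid charge_mem by auto
  have fin: "finite S" if "S \<subseteq> elems ?I" for S
    using coset_inst_inst_of[OF ty(1)] finite_subset[OF that] by (simp add: coset_inst_def inst_over_def)
  interpret confusable T \<G> A d ?I ?I' free
  proof
    show "coset_inst T \<G> ?I" "coset_inst T \<G> (?I' j)" for j
      using ty coset_inst_inst_of by auto
    then show "L0 T \<G> A d ?I i \<or> (L1 T \<G> A d ?I i \<and> L2 \<G> A d ?I i)" if "i \<in> {1..stages A ?I}" for i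
      using d that by blast
    show "elems (?I' j) = elems ?I" for j by (rule elems_grid)
    show "presolutions \<G> (?I' j) = presolutions \<G> ?I" for j
      using presolutions_inst_of[OF ty(1)] presolutions_inst_of[OF ty(2)]
        elems_grid[of "charge j" "\<lambda>_. \<one>\<^bsub>G\<^esub>"] by simp
    show "free S' \<subseteq> free S" if "S \<subseteq> S'" for S S' using that by (auto simp: free_def)
    show "free S \<noteq> {}" if "finite S" "card S \<le> d + d * d" for S
      using free_line[of Inl S] that n by (auto simp: free_def inj_def)
    show "restrict_inst (?I' j) S = restrict_inst ?I S" if "j \<in> free S" for S j
    proof (rule restrict_grid)
      fix l assume "\<iota> (V0 (Col 0 l)) \<in> S"
      then have "Inl l \<in> (\<lambda>x. line (\<kappa> x)) ` S" by (rule rev_image_eqI) simp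
      then show "charge j l = \<one>\<^bsub>G\<^esub>" using that by (auto simp: free_def charge_def)
    qed
    show "\<exists>s \<in> presolutions \<G> ?I. fixes_on \<G> ?I s S \<and> translate \<G> (?I' j) s = ?I' j'"
      if S: "S \<subseteq> elems ?I" "card S \<le> d" "j \<in> free S" "j' \<in> free S" "j \<noteq> j'" for S j j'
    proof -
      let ?E = "elems (inst_of (grid_constrs (\<lambda>_. \<one>\<^bsub>G\<^esub>)))"
      \<comment> \<open>The row through which the charge is moved must avoid \<open>S\<close>, so
        that the translation fixes \<open>S\<close>.\<close>
      obtain i where i: "i < n" "Inr i \<notin> (\<lambda>x. line (\<kappa> x)) ` S"
        using free_line[of Inr S] fin[OF S(1)] S(2) n by (auto simp: inj_def)
      define f where "f = (\<lambda>x. mover i j j' (\<kappa> x))"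
      have "restrict f ?E \<in> presolutions \<G> ?I"
        unfolding presolutions_inst_of[OF ty(1)] using mover_mem by (auto simp: f_def \<Gamma>_def)
      moreover have "fixes_on \<G> ?I (restrict f ?E) S"
        unfolding fixes_on_def
      proof
        fix x assume x: "x \<in> S"
        then have "line (\<kappa> x) \<in> (\<lambda>x. line (\<kappa> x)) ` S" by blast
        then have "line (\<kappa> x) \<notin> {Inl j, Inl j', Inr i}" using S(3,4) i(2) by (auto simp: free_def)
        then have "f x = \<one>\<^bsub>\<Gamma> x\<^esub>" unfolding f_def \<Gamma>_def by (rule mover_line)
        then show "restrict f ?E x = \<one>\<^bsub>cgroup \<G> ?I x\<^esub>"
          using cgroup_inst_of[OF ty(1)] x S(1) by auto
      qed
      moreover have "translate \<G> (?I' j) (restrict f ?E) = ?I' j'"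
      proof -
        have "translate \<G> (?I' j) (restrict f ?E) = inst_of (shift \<Gamma> f ` grid_constrs (charge j))"
          using elems_grid[of "charge j" "\<lambda>_. \<one>\<^bsub>G\<^esub>"] by (intro translate_inst_of ty) auto
        also have "shift \<Gamma> f ` grid_constrs (charge j) = grid_constrs (charge j')"
          using S i unfolding f_def by (intro shift_grid) (auto simp: free_def)
        finally show ?thesis .
      qed
      ultimately show ?thesis by blast
    qed
  qed (use A in auto)
  obtain j where j: "j < n" "accepts A (?I' j) \<longleftrightarrow> accepts A ?I"
    using accepts_eq by (auto simp: free_def)
  have "accepts A ?I"
    using solves ty(1) coset_inst_inst_of ex_solution_inst_of satisfiable_uncharged
    unfolding solves_CSP_def by blast
  moreover have "\<not> accepts A (?I' j)"
    using solves ty(2) coset_inst_inst_of ex_solution_inst_of unsatisfiable_charged[OF j(1)]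
    unfolding solves_CSP_def by blast
  ultimately show False using j by blast
qed

end

section \<open>From anomalies to gadgets\<close>

definition total_solution :: "'t template \<Rightarrow> ('t, 'e) inst \<Rightarrow> ('e \<Rightarrow> 't) \<Rightarrow> bool" where
  "total_solution T I v \<longleftrightarrow> (\<forall>a \<in> elems I. v a \<in> tcarrier T) \<and> satisfies v (constrs I)"

lemma extends_iff_total_solution:
  assumes "inst_over T I" "Z \<subseteq> dom h" "dom h \<subseteq> elems I"
  shows "extends_to_solution T I (h |` Z) \<longleftrightarrow> (\<exists>v. total_solution T I v \<and> (\<forall>b \<in> Z. v b = the (h b)))"
proof
  assume "extends_to_solution T I (h |` Z)"
  then obtain g where g: "dom g = elems I" "ran g \<subseteq> tcarrier T" "h |` Z \<subseteq>\<^sub>m g"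
      "\<forall>((n, R), as) \<in> constrs I. set as \<subseteq> dom g \<longrightarrow> map (\<lambda>a. the (g a)) as \<in> R"
    by (auto simp: extends_to_solution_def solution_def partial_solution_def)
  have "total_solution T I (\<lambda>a. the (g a))"
    unfolding total_solution_def
  proof (intro conjI ballI satisfiesI)
    fix a assume "a \<in> elems I"
    then obtain y where "g a = Some y" using g(1) by blast
    then show "the (g a) \<in> tcarrier T" using g(2) by (auto simp: ran_def)
  next
    fix n R as assume c: "((n, R), as) \<in> constrs I"
    then have "set as \<subseteq> elems I" using assms(1) by (auto simp: inst_over_def)
    then show "map (\<lambda>a. the (g a)) as \<in> R" using bspec[OF g(4) c] g(1) by simp
  qed
  moreover have "the (g b) = the (h b)" if "b \<in> Z" for b
    using g(3) that assms(2) unfolding map_le_def by (metis Int_iff dom_restrict restrict_in subsetD)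
  ultimately show "\<exists>v. total_solution T I v \<and> (\<forall>b \<in> Z. v b = the (h b))" by blast
next
  assume "\<exists>v. total_solution T I v \<and> (\<forall>b \<in> Z. v b = the (h b))"
  then obtain v where v: "\<forall>a \<in> elems I. v a \<in> tcarrier T" "satisfies v (constrs I)"
    "\<forall>b \<in> Z. v b = the (h b)" by (auto simp: total_solution_def)
  define g where "g a = (if a \<in> elems I then Some (v a) else None)" for a
  have dom: "dom g = elems I" by (auto simp: g_def split: if_splits)
  have "ran g \<subseteq> tcarrier T" using v(1) by (auto simp: ran_def g_def split: if_splits)
  moreover have "map (\<lambda>a. the (g a)) as \<in> R" if c: "((n, R), as) \<in> constrs I" for n R as
  proof -
    have "set as \<subseteq> elems I" using assms(1) c by (auto simp: inst_over_def)
    then have "map (\<lambda>a. the (g a)) as = map v as" by (auto simp: g_def)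
    then show ?thesis using satisfiesD[OF v(2) c] by (simp only:)
  qed
  ultimately have "solution T I g"
    unfolding solution_def partial_solution_def using dom by auto
  moreover have "h |` Z \<subseteq>\<^sub>m g"
    unfolding map_le_def
  proof
    fix b assume "b \<in> dom (h |` Z)"
    then have b: "b \<in> Z" "b \<in> dom h" by (auto split: if_splits)
    then show "(h |` Z) b = g b" using v(3) assms(3) by (auto simp: g_def)
  qed
  ultimately show "extends_to_solution T I (h |` Z)" unfolding extends_to_solution_def by blast
qed

text \<open>\<open>Y\<close> is a smallest subset of the domain on which \<open>h\<close> does not
  extend. Since all pairs extend, and so all sets contained in a pair, \<open>Y\<close> has at least
  three points; by minimality, dropping any of them restores extendability.\<close>

lemma minimal_anomaly:
  assumes I: "inst_over T I" and h: "anomaly T I 2 j h"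
  obtains Y a0 a1 a2 where "Y \<subseteq> elems I" "finite Y" "a0 \<in> Y" "a1 \<in> Y" "a2 \<in> Y"
    "a0 \<noteq> a1" "a0 \<noteq> a2" "a1 \<noteq> a2"
    "\<And>a. a \<in> Y \<Longrightarrow> \<exists>v. total_solution T I v \<and> (\<forall>b \<in> Y - {a}. v b = the (h b))"
    "\<And>v. total_solution T I v \<Longrightarrow> \<exists>b \<in> Y. v b \<noteq> the (h b)"
proof -
  have dom: "dom h \<subseteq> elems I" "finite (dom h)" "card (dom h) > 2"
    and not_ext: "\<not> extends_to_solution T I h"
    and ext2: "\<And>Y. Y \<subseteq> dom h \<Longrightarrow> card Y = 2 \<Longrightarrow> extends_to_solution T I (h |` Y)"
    using h by (auto simp: anomaly_def partial_solution_def intro: card_ge_0_finite)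
  define ext where "ext Z \<longleftrightarrow> (\<exists>v. total_solution T I v \<and> (\<forall>b \<in> Z. v b = the (h b)))" for Z
  have ext: "extends_to_solution T I (h |` Z) \<longleftrightarrow> ext Z" if "Z \<subseteq> dom h" for Z
    unfolding ext_def by (rule extends_iff_total_solution[OF I that dom(1)])
  have ext_mono: "ext Z" if "Z \<subseteq> Z'" "ext Z'" for Z Z' using that unfolding ext_def by blast
  have "h |` dom h = h" by (auto simp: restrict_map_def fun_eq_iff domIff)
  then have "dom h \<subseteq> dom h \<and> \<not> ext (dom h)" using ext[of "dom h"] not_ext by simp
  then obtain Y where Y: "Y \<subseteq> dom h" "\<not> ext Y"
    and min: "\<And>Z. Z \<subseteq> dom h \<Longrightarrow> \<not> ext Z \<Longrightarrow> card Y \<le> card Z"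
    using ex_has_least_nat[of "\<lambda>Y. Y \<subseteq> dom h \<and> \<not> ext Y" "dom h" card] by blast
  have fin: "finite Y" using Y dom finite_subset by blast
  have "card Y \<ge> 3"
  proof (rule ccontr)
    assume "\<not> card Y \<ge> 3"
    then obtain Z where "Y \<subseteq> Z" "Z \<subseteq> dom h" "card Z = 2"
      using exists_subset_between[of Y 2 "dom h"] Y dom by auto
    then show False using ext2[of Z] ext[of Z] ext_mono[of Y Z] Y by blast
  qed
  then obtain Z where "Z \<subseteq> Y" "card Z = 3" by (metis obtain_subset_with_card_n)
  then obtain a0 a1 a2 where a: "a0 \<in> Y" "a1 \<in> Y" "a2 \<in> Y" "a0 \<noteq> a1" "a0 \<noteq> a2" "a1 \<noteq> a2"
    by (auto simp: card_3_iff)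
  have "ext (Y - {a})" if "a \<in> Y" for a
    using min[of "Y - {a}"] Y(1) card_Diff1_less[OF fin that] by fastforce
  then have 1: "\<exists>v. total_solution T I v \<and> (\<forall>b \<in> Y - {a}. v b = the (h b))" if "a \<in> Y" for a
    using that unfolding ext_def by blast
  have 2: "\<exists>b \<in> Y. v b \<noteq> the (h b)" if "total_solution T I v" for v
    using Y(2) that unfolding ext_def by blast
  show thesis using that[OF _ fin a 1 2] Y(1) dom(1) by blast
qed

context coset_tmpl
begin

text \<open>A coset through the tuple $v$ has the form $H v$, so translating it by $v^{-1}$ yields
  the subgroup $H$.\<close>

lemma relation_through:
  assumes "(n, R) \<in> trels T" "length as = n" "map v as \<in> R"
    "\<And>a. \<gamma> a \<in> \<G>" "\<And>a. a \<in> set as \<Longrightarrow> v a \<in> carrier (\<gamma> a)"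
  shows "R \<subseteq> carrier (DirProd_list (map \<gamma> as))"
    "subgroup (R #>\<^bsub>DirProd_list (map \<gamma> as)\<^esub> map (\<lambda>a. inv\<^bsub>\<gamma> a\<^esub> v a) as) (DirProd_list (map \<gamma> as))"
proof -
  let ?D = "DirProd_list (map \<gamma> as)"
  obtain Gs H where H: "length Gs = n" "set Gs \<subseteq> \<G>" "subgroup H (DirProd_list Gs)"
    "R \<in> rcosets\<^bsub>DirProd_list Gs\<^esub> H" "group (DirProd_list Gs)" "R \<subseteq> carrier (DirProd_list Gs)"
    using relation_coset[OF assms(1)] .
  have v: "map v as \<in> carrier ?D" using assms(5) by (simp add: map_mem_DirProd_list)
  have "Gs = map \<gamma> as"
    by (rule relation_group_unique[OF assms(1) H(1,2) _ _ _ v]) (use assms H(6) in auto)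
  then have H': "subgroup H ?D" "R \<in> rcosets\<^bsub>?D\<^esub> H" "group ?D" "R \<subseteq> carrier ?D" using H by auto
  then show "R \<subseteq> carrier ?D" by simp
  interpret D: group ?D by (rule H'(3))
  have R: "R = H #>\<^bsub>?D\<^esub> map v as"
    using H'(2) assms(3) D.repr_independence[OF _ _ H'(1)] by (auto simp: RCOSETS_def)
  have "inv\<^bsub>?D\<^esub> map v as = map (\<lambda>a. inv\<^bsub>\<gamma> a\<^esub> v a) as"
    using assms(4,5) group_carrier by (intro inv_DirProd_list_map) auto
  moreover have "R #>\<^bsub>?D\<^esub> inv\<^bsub>?D\<^esub> map v as = H"
    using R v D.coset_mult_assoc[OF subgroup.subset[OF H'(1)] v] subgroup.subset[OF H'(1)] by simp
  ultimately show "subgroup (R #>\<^bsub>?D\<^esub> map (\<lambda>a. inv\<^bsub>\<gamma> a\<^esub> v a) as) ?D" using H'(1) by simp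
qed

text \<open>Everything is translated by the inverse of a solution \<open>w\<close> that agrees with
  \<open>h\<close> on \<open>Y\<close> except at \<open>a0\<close>. Solutions agreeing with
  \<open>h\<close> except at \<open>a1\<close> or \<open>a2\<close> become \<open>p\<close> and
  \<open>q\<close>.\<close>

lemma ex_gadget:
  fixes I :: "('t, 'e) inst"
  assumes I: "inst_over T I" and h: "anomaly T I 2 j h"
  shows "\<exists>(\<gamma> :: 'e \<Rightarrow> 't monoid) Q a0 a1 a2 p q. gadget T \<G> \<gamma> Q a0 a1 a2 p q"
proof -
  obtain Y a0 a1 a2 where Y: "Y \<subseteq> elems I" "finite Y" and a: "a0 \<in> Y" "a1 \<in> Y" "a2 \<in> Y"
    "a0 \<noteq> a1" "a0 \<noteq> a2" "a1 \<noteq> a2"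
    and ext: "\<And>a. a \<in> Y \<Longrightarrow> \<exists>v. total_solution T I v \<and> (\<forall>b \<in> Y - {a}. v b = the (h b))"
    and not_ext: "\<And>v. total_solution T I v \<Longrightarrow> \<exists>b \<in> Y. v b \<noteq> the (h b)"
    using minimal_anomaly[OF I h] by blast
  define y where "y b = the (h b)" for b
  obtain w where w: "total_solution T I w" "\<forall>b \<in> Y - {a0}. w b = y b" using ext[OF a(1)] by (auto simp: y_def)
  obtain v1 where v1: "total_solution T I v1" "\<forall>b \<in> Y - {a1}. v1 b = y b" using ext[OF a(2)] by (auto simp: y_def)
  obtain v2 where v2: "total_solution T I v2" "\<forall>b \<in> Y - {a2}. v2 b = y b" using ext[OF a(3)] by (auto simp: y_def)
  \<comment> \<open>The value \<open>w a0\<close> outside the instance makes every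
    \<open>v b\<close> lie in some carrier group, so that \<open>\<gamma>\<close> can be
    total.\<close>
  define v where "v b = (if b \<in> elems I then w b else w a0)" for b
  have as_elems: "set as \<subseteq> elems I" "(n, R) \<in> trels T" "length as = n" if "((n, R), as) \<in> constrs I" for n R as
    using I that by (auto simp: inst_over_def)
  have v_rel: "map v as \<in> R" if "((n, R), as) \<in> constrs I" for n R as
  proof -
    have "map v as = map w as" using as_elems[OF that] by (auto simp: v_def)
    moreover have "map w as \<in> R" using w(1) satisfiesD[OF _ that] unfolding total_solution_def by blast
    ultimately show ?thesis by (simp only:)
  qed
  have "\<exists>G \<in> \<G>. v b \<in> carrier G" for b
    using w(1) a(1) Y(1) by (intro mem_carrier_group) (auto simp: total_solution_def v_def)
  then obtain \<gamma> where \<gamma>: "\<And>b. \<gamma> b \<in> \<G>" "\<And>b. v b \<in> carrier (\<gamma> b)" by metis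
  have grp: "group (\<gamma> b)" for b using \<gamma>(1) group_carrier by blast
  note R_sub = relation_through(1)[OF as_elems(2,3) v_rel \<gamma>]
  note R_subgroup = relation_through(2)[OF as_elems(2,3) v_rel \<gamma>]
  have sat_carrier: "u b \<in> carrier (\<gamma> b)"
    if "satisfies u (constrs I)" "((n, R), as) \<in> constrs I" "b \<in> set as" for u n R as b
  proof -
    have "map u as \<in> carrier (DirProd_list (map \<gamma> as))"
      using satisfiesD[OF that(1,2)] R_sub[OF that(2,2,2)] by blast
    then show ?thesis using that(3) by (simp add: map_mem_DirProd_list)
  qed
  define Q1 where "Q1 = shift \<gamma> (\<lambda>b. inv\<^bsub>\<gamma> b\<^esub> v b) ` constrs I"
  \<comment> \<open>Agreement with \<open>h\<close> on the rest of \<open>Y\<close> becomes the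
    value one there, which the template can express.\<close>
  define Q2 where "Q2 = (\<lambda>b. ((1::nat, {[\<one>\<^bsub>\<gamma> b\<^esub>]}), [b])) ` (Y - {a0, a1, a2})"
  have D: "group (DirProd_list (map \<gamma> as))" for as by (rule group_DirProd_list_map) (simp add: grp)
  have inv_carrier: "inv\<^bsub>\<gamma> b\<^esub> v b \<in> carrier (\<gamma> b)" for b
    by (rule group.inv_closed[OF grp \<gamma>(2)])
  \<comment> \<open>The default is used only at points that occur in no constraint, since
    \<open>u\<close> satisfies the constraints.\<close>
  have Q1: "satisfies (\<lambda>b. if u b \<in> carrier (\<gamma> b) then u b \<otimes>\<^bsub>\<gamma> b\<^esub> inv\<^bsub>\<gamma> b\<^esub> v b else \<one>\<^bsub>\<gamma> b\<^esub>) Q1"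
    (is "satisfies ?u _") if u: "satisfies u (constrs I)" for u
  proof (rule satisfiesI)
    fix n R' as assume "((n, R'), as) \<in> Q1"
    then obtain R where c: "((n, R), as) \<in> constrs I"
      and R': "R' = R #>\<^bsub>DirProd_list (map \<gamma> as)\<^esub> map (\<lambda>b. inv\<^bsub>\<gamma> b\<^esub> v b) as"
      by (auto simp: Q1_def shift_def)
    have "map ?u as = map (\<lambda>b. u b \<otimes>\<^bsub>\<gamma> b\<^esub> inv\<^bsub>\<gamma> b\<^esub> v b) as"
      using sat_carrier[OF u c] by auto
    also have "\<dots> = map u as \<otimes>\<^bsub>DirProd_list (map \<gamma> as)\<^esub> map (\<lambda>b. inv\<^bsub>\<gamma> b\<^esub> v b) as"
      using sat_carrier[OF u c] inv_carrier by (intro mult_DirProd_list_map[symmetric]) auto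
    also have "\<dots> \<in> R'" unfolding R' r_coset_def using satisfiesD[OF u c] by blast
    finally show "map ?u as \<in> R'" .
  qed
  have Q1_back: "map (\<lambda>b. r b \<otimes>\<^bsub>\<gamma> b\<^esub> v b) as \<in> R \<and> (\<forall>b \<in> set as. r b \<in> carrier (\<gamma> b))"
    if r: "satisfies r Q1" and c: "((n, R), as) \<in> constrs I" for r n R as
  proof -
    let ?D = "DirProd_list (map \<gamma> as)"
    interpret D: group ?D by (rule D)
    have "((n, R #>\<^bsub>?D\<^esub> map (\<lambda>b. inv\<^bsub>\<gamma> b\<^esub> v b) as), as) \<in> Q1"
      unfolding Q1_def using c by (rule rev_image_eqI) (simp add: shift_def)
    from satisfiesD[OF r this] obtain t where t: "t \<in> R" "map r as = t \<otimes>\<^bsub>?D\<^esub> map (\<lambda>b. inv\<^bsub>\<gamma> b\<^esub> v b) as"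
      by (auto simp: r_coset_def)
    have tc: "t \<in> carrier ?D" using t(1) R_sub[OF c c c] by blast
    have vc: "map v as \<in> carrier ?D" using \<gamma>(2) by (simp add: map_mem_DirProd_list)
    have inv: "map (\<lambda>b. inv\<^bsub>\<gamma> b\<^esub> v b) as = inv\<^bsub>?D\<^esub> map v as"
      using grp \<gamma>(2) by (intro inv_DirProd_list_map[symmetric]) auto
    have "map r as \<in> carrier ?D" unfolding t(2) inv using tc vc by simp
    then have rc: "\<forall>b \<in> set as. r b \<in> carrier (\<gamma> b)" by (simp add: map_mem_DirProd_list)
    then have "map (\<lambda>b. r b \<otimes>\<^bsub>\<gamma> b\<^esub> v b) as = map r as \<otimes>\<^bsub>?D\<^esub> map v as"
      using \<gamma>(2) by (intro mult_DirProd_list_map[symmetric]) auto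
    also have "\<dots> = t" unfolding t(2) inv using tc vc by (simp add: D.m_assoc)
    finally show ?thesis using t(1) rc by simp
  qed
  have v_Y: "v b = y b" if "b \<in> Y" "b \<noteq> a0" for b using that w(2) Y(1) by (auto simp: v_def)
  define P where "P u b = (if u b \<in> carrier (\<gamma> b) then u b \<otimes>\<^bsub>\<gamma> b\<^esub> inv\<^bsub>\<gamma> b\<^esub> v b else \<one>\<^bsub>\<gamma> b\<^esub>)" for u b
  have P_eq: "P u b = \<one>\<^bsub>\<gamma> b\<^esub>" if "u b = v b" for u b
    using that group.r_inv[OF grp \<gamma>(2)] by (simp add: P_def)
  have P_carrier: "P u b \<in> carrier (\<gamma> b)" for u b
    using monoid.m_closed[OF group.is_monoid[OF grp] _ inv_carrier] monoid.one_closed[OF group.is_monoid[OF grp]]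
    by (simp add: P_def)
  have P_sat: "satisfies (P u) (Q1 \<union> Q2)"
    if "total_solution T I u" "\<And>b. b \<in> Y - {a0, a1, a2} \<Longrightarrow> u b = y b" for u
  proof -
    have "satisfies (P u) Q1" using Q1[of u] that(1) by (simp add: total_solution_def P_def[abs_def])
    moreover have "\<forall>b \<in> Y - {a0, a1, a2}. P u b = \<one>\<^bsub>\<gamma> b\<^esub>" using P_eq that(2) v_Y by auto
    ultimately show ?thesis unfolding satisfies_Un Q2_def satisfies_singletons by blast
  qed
  have "gadget T \<G> \<gamma> (Q1 \<union> Q2) a0 a1 a2 (P v1) (P v2)"
  proof
    show "\<gamma> b \<in> \<G>" for b by (rule \<gamma>(1))
    show "finite (Q1 \<union> Q2)" using I Y(2) by (simp add: Q1_def Q2_def inst_over_def)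
    show "P v1 b \<in> carrier (\<gamma> b)" "P v2 b \<in> carrier (\<gamma> b)" for b by (rule P_carrier)+
    show "satisfies (P v1) (Q1 \<union> Q2)" "satisfies (P v2) (Q1 \<union> Q2)"
      using P_sat v1 v2 by auto
    show "P v1 a2 = \<one>\<^bsub>\<gamma> a2\<^esub>" "P v2 a1 = \<one>\<^bsub>\<gamma> a1\<^esub>"
      using v1(2) v2(2) a v_Y by (auto intro: P_eq)
    show "P v2 a0 = P v1 a0" using v1(2) v2(2) a by (simp add: P_def)
    show "a0 \<noteq> a1" "a0 \<noteq> a2" "a1 \<noteq> a2" using a by auto
    show "(n, R) \<in> trels T \<and> length as = n \<and> subgroup R (DirProd_list (map \<gamma> as))"
      if "((n, R), as) \<in> Q1 \<union> Q2" for n R as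
      using that
    proof
      assume "((n, R), as) \<in> Q1"
      then obtain R0 where c: "((n, R0), as) \<in> constrs I"
        and R: "R = R0 #>\<^bsub>DirProd_list (map \<gamma> as)\<^esub> map (\<lambda>b. inv\<^bsub>\<gamma> b\<^esub> v b) as"
        by (auto simp: Q1_def shift_def)
      have "(n, R) \<in> trels T"
        unfolding R using as_elems[OF c] R_sub[OF c c c] \<gamma>(1) inv_carrier
        by (intro relation_translate) (auto simp: map_mem_DirProd_list)
      then show ?thesis using R_subgroup[OF c c c] as_elems(3)[OF c] R by simp
    next
      assume "((n, R), as) \<in> Q2"
      then obtain b where "n = 1" "R = {[\<one>\<^bsub>\<gamma> b\<^esub>]}" "as = [b]" by (auto simp: Q2_def)
      then show ?thesis
        using relation_one[OF \<gamma>(1)] group.triv_subgroup[OF D[of "[b]"]] one_DirProd_list_map[of \<gamma> "[b]"] by simp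
    qed
    show "\<not> (\<exists>r. satisfies r (Q1 \<union> Q2) \<and> r a0 = P v1 a0 \<and> r a1 = \<one>\<^bsub>\<gamma> a1\<^esub> \<and> r a2 = \<one>\<^bsub>\<gamma> a2\<^esub>)"
    proof
      assume "\<exists>r. satisfies r (Q1 \<union> Q2) \<and> r a0 = P v1 a0 \<and> r a1 = \<one>\<^bsub>\<gamma> a1\<^esub> \<and> r a2 = \<one>\<^bsub>\<gamma> a2\<^esub>"
      then obtain r where r: "satisfies r Q1" "\<forall>b \<in> Y - {a0, a1, a2}. r b = \<one>\<^bsub>\<gamma> b\<^esub>"
        and ra: "r a0 = P v1 a0" "r a1 = \<one>\<^bsub>\<gamma> a1\<^esub>" "r a2 = \<one>\<^bsub>\<gamma> a2\<^esub>"
        unfolding satisfies_Un Q2_def satisfies_singletons by blast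
      \<comment> \<open>Translating \<open>r\<close> back by \<open>v\<close> would extend
        \<open>h\<close> on all of \<open>Y\<close>. The values of \<open>h\<close> are put in
        directly on \<open>Y\<close>, and \<open>v\<close> is the default for elements without
        constraints; on constrained elements \<open>F\<close> equals the translate.\<close>
      define F where "F b = (if b \<in> Y then y b else if r b \<in> carrier (\<gamma> b) then r b \<otimes>\<^bsub>\<gamma> b\<^esub> v b else v b)" for b
      have r_one: "r b = \<one>\<^bsub>\<gamma> b\<^esub>" if "b \<in> Y" "b \<noteq> a0" for b using r(2) ra that by auto
      have tcarrier: "x \<in> tcarrier T" if "x \<in> carrier (\<gamma> b)" for x b
        using coset_template \<gamma>(1)[of b] that unfolding coset_template_def by blast
      have "total_solution T I F"
        unfolding total_solution_def
      proof (intro conjI ballI satisfiesI)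
        fix b assume b: "b \<in> elems I"
        have "y b \<in> tcarrier T" if "b \<in> Y"
        proof (cases "b = a0")
          case True
          then show ?thesis using v1 a b by (auto simp: total_solution_def)
        next
          case False
          then show ?thesis using v_Y that tcarrier \<gamma>(2) by metis
        qed
        moreover have "r b \<otimes>\<^bsub>\<gamma> b\<^esub> v b \<in> carrier (\<gamma> b)" if "r b \<in> carrier (\<gamma> b)"
          by (rule monoid.m_closed[OF group.is_monoid[OF grp] that \<gamma>(2)])
        ultimately show "F b \<in> tcarrier T" using tcarrier[of _ b] \<gamma>(2)[of b] unfolding F_def by presburger
      next
        fix n R as assume c: "((n, R), as) \<in> constrs I"
        note r_as = Q1_back[OF r(1) c]
        have "F b = r b \<otimes>\<^bsub>\<gamma> b\<^esub> v b" if "b \<in> set as" for b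
        proof -
          consider "b \<notin> Y" | "b = a0" | "b \<in> Y" "b \<noteq> a0" by blast
          then show ?thesis
          proof cases
            case 1
            then show ?thesis using r_as that by (simp add: F_def)
          next
            case 2
            interpret group "\<gamma> a0" by (rule grp)
            have "v1 a0 = y a0" using v1(2) a by simp
            moreover have "v1 a0 \<in> carrier (\<gamma> a0)"
              using sat_carrier[OF _ c, of v1 a0] v1(1) that 2 by (simp add: total_solution_def)
            ultimately show ?thesis
              using 2 ra(1) a(1) \<gamma>(2)[of a0] by (simp add: F_def P_def m_assoc)
          next
            case 3
            then show ?thesis using r_one v_Y monoid.l_one[OF group.is_monoid[OF grp] \<gamma>(2), of b] by (simp add: F_def)
          qed
        qed
        then have "map F as = map (\<lambda>b. r b \<otimes>\<^bsub>\<gamma> b\<^esub> v b) as" by simp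
        then show "map F as \<in> R" using r_as by (simp only:)
      qed
      then show False using not_ext[of F] by (auto simp: F_def y_def)
    qed
  qed
  then show ?thesis by blast
qed

end

text \<open>A node consists of countable data and at most one element of the type, and an infinite
  type absorbs a countable factor.\<close>

lemma ex_inj_node: "\<exists>\<iota> :: 'e::infinite node \<Rightarrow> 'e. inj \<iota>"
proof -
  define code :: "'e node \<Rightarrow> nat \<times> 'e" where "code b = (case b of
      V0 w \<Rightarrow> (to_nat (0::nat, to_nat w), undefined)
    | V1 w \<Rightarrow> (to_nat (1::nat, to_nat w), undefined)
    | V2 w \<Rightarrow> (to_nat (2::nat, to_nat w), undefined)
    | One1 \<Rightarrow> (to_nat (3::nat, 0::nat), undefined)
    | One2 \<Rightarrow> (to_nat (4::nat, 0::nat), undefined)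
    | Inner k a \<Rightarrow> (to_nat (5::nat, to_nat k), a))" for b
  have "inj code"
    by (rule injI) (auto simp: code_def split: node.splits)
  moreover have "|UNIV :: (nat \<times> 'e) set| \<le>o |UNIV :: 'e set|"
    unfolding UNIV_Times_UNIV[symmetric]
    using card_of_Times_ordLeq_infinite[of "UNIV :: 'e set" "UNIV :: nat set" "UNIV :: 'e set"]
      infinite_UNIV[where 'a = 'e] infinite_iff_card_of_nat[of "UNIV :: 'e set"] card_of_refl ordIso_imp_ordLeq
    by blast
  then obtain f :: "nat \<times> 'e \<Rightarrow> 'e" where "inj f"
    using card_of_ordLeq[of "UNIV :: (nat \<times> 'e) set" "UNIV :: 'e set"] by auto
  ultimately have "inj (f \<circ> code)" by (rule inj_compose[rotated])
  then show ?thesis by blast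
qed

theorem theorem1:
  fixes T :: "'t template" and \<G> :: "'t monoid set"
    and A :: "('t, 'e::infinite, 'o) algorithm"
  assumes "coset_template T \<G>"
    and "local_equivariant T \<G> A"
    and "solves_CSP T \<G> A"
  shows "two_helly TYPE('e) T"
  unfolding two_helly_def
proof (intro allI impI notI)
  fix I :: "('t, 'e) inst" and j :: nat
  assume I: "inst_over T I" and "2 < j" and "\<exists>h. anomaly T I 2 j h"
  then obtain h where h: "anomaly T I 2 j h" by blast
  interpret coset_tmpl T \<G> by unfold_locales (rule assms(1))
  obtain \<gamma> Q a0 a1 a2 p q where gadget: "gadget T \<G> \<gamma> Q a0 a1 a2 (p :: 'e \<Rightarrow> 't) q"
    using ex_gadget[OF I h] by blast
  obtain \<iota> :: "'e node \<Rightarrow> 'e" where "inj \<iota>" using ex_inj_node by blast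
  obtain d where "\<forall>I. coset_inst T \<G> I \<longrightarrow> (\<forall>i \<in> {1..stages A I}.
      L0 T \<G> A d I i \<or> (L1 T \<G> A d I i \<and> L2 \<G> A d I i))"
    using assms(2) unfolding local_equivariant_def by blast
  then have d: "\<And>I i. coset_inst T \<G> I \<Longrightarrow> i \<in> {1..stages A I} \<Longrightarrow>
      L0 T \<G> A d I i \<or> (L1 T \<G> A d I i \<and> L2 \<G> A d I i)" by blast
  \<comment> \<open>More than \<open>d + d * d\<close> lines are needed, since the induction must
    avoid a set of up to that many elements.\<close>
  interpret grid T \<G> \<gamma> Q a0 a1 a2 p q \<iota> "Suc (d + d * d)"
    using gadget \<open>inj \<iota>\<close> by (simp add: grid_def grid_axioms_def)
  show False
    by (rule algorithm_fooled[OF _ _ d _ assms(3)]) (use assms(2) in \<open>simp_all add: local_equivariant_def\<close>)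
qed

end
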